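(* Let $G$ be a finitely generated group. Assume that there exist $p\in(1,2]$, $\alpha\in(0,1)$ and an increasing slowly varying function $\ell$ such that, for all $v\ge1$, $$\Lambda_{p,\mathbf u}(v)\le\frac{\ell(\log(e+v))}{[\log(e+v)]^{1/\alpha}} .$$ Then, for any symmetric probability measure $\mu$ on $G$ with finite $p$-moment $\sum_{g}|g|^p\mu(g)<\infty$, $$H_\mu(n)\le C(\mu,p,\omega)\,n^\alpha\,\omega(n)$$ for any increasing slowly varying function $\omega$ such that, for some $\eta>1$ and $\epsilon>0$, $$\ell(y^{\alpha\eta})^\alpha\,[\log(e+y^{\alpha\eta})]^{\alpha(1+\epsilon)}\le\omega(y)\quad\text{for all } y\geq 1.$$ Further, for such $\omega$, $$L_\mu(n)\le C(\mu,p,\omega)\,n^{[(3-p)+\alpha(p-1)]/2}\,\omega(n)^{(p-1)/2}.$$ Here $n\geq 1$ is an arbitrary integer and $C(\mu,p,\omega)$ is a finite constant not depending on $n$.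
   Context: $G$ is equipped with a fixed generating tuple $S=(s_1,\dots,s_k)$; $S^*=\{e,s_1^{\pm1},\dots,s_k^{\pm1}\}$, $|\cdot|$ is the associated word length, and $\mathbf u$ is the uniform probability measure on $S^*$. For a symmetric probability measure $\phi$ on $G$ and $p\ge1$, $\mathcal E_{p,\phi}(f)=\frac12\sum_{x,y\in G}|f(xy)-f(x)|^p\phi(y)$ and $$\Lambda_{p,\phi}(v)=\inf\{\mathcal E_{p,\phi}(f):|\mathrm{support}(f)|\le v,\ \|f\|_p=1\}.$$ $\mu^{(n)}$ is the $n$-fold convolution power of $\mu$, $H_\mu(n)=\sum_{g\in G}(-\log\mu^{(n)}(g))\mu^{(n)}(g)$ and $L_\mu(n)=\sum_{g\in G}|g|\mu^{(n)}(g)$. The functions $\ell,\omega$ are positive functions on $[1,\infty)$, slowly varying at infinity. *)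

theory Defs
  imports "HOL-Probability.Probability" "HOL-Algebra.Generated_Groups"
begin

text \<open>
  Probability measures on the (countable) group \<open>G\<close> are probability mass functions supported in
  \<open>carrier G\<close>. Sums of nonnegative terms that need not be finite a priori (energy, entropy, drift)
  take values in \<open>ennreal\<close>, so that a divergent sum is \<open>\<infinity>\<close> rather than \<open>0\<close>.
\<close>

definition generating_tuple :: "('a, 'm) monoid_scheme \<Rightarrow> 'a list \<Rightarrow> bool" where
  "generating_tuple G S \<longleftrightarrow> set S \<subseteq> carrier G \<and> generate G (set S) = carrier G"

definition sym_gens :: "('a, 'm) monoid_scheme \<Rightarrow> 'a list \<Rightarrow> 'a set" where
  "sym_gens G S = {\<one>\<^bsub>G\<^esub>} \<union> set S \<union> (\<lambda>s. inv\<^bsub>G\<^esub> s) ` set S"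

definition word_length :: "('a, 'm) monoid_scheme \<Rightarrow> 'a list \<Rightarrow> 'a \<Rightarrow> nat" where
  "word_length G S g =
     (LEAST n. \<exists>w. length w = n \<and> set w \<subseteq> sym_gens G S \<and> foldr (\<lambda>x y. x \<otimes>\<^bsub>G\<^esub> y) w \<one>\<^bsub>G\<^esub> = g)"

definition unif_gens :: "('a, 'm) monoid_scheme \<Rightarrow> 'a list \<Rightarrow> 'a pmf" where
  "unif_gens G S = pmf_of_set (sym_gens G S)"

definition symmetric_measure :: "('a, 'm) monoid_scheme \<Rightarrow> 'a pmf \<Rightarrow> bool" where
  "symmetric_measure G \<phi> \<longleftrightarrow>
     set_pmf \<phi> \<subseteq> carrier G \<and> (\<forall>g\<in>carrier G. pmf \<phi> (inv\<^bsub>G\<^esub> g) = pmf \<phi> g)"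

definition energy :: "('a, 'm) monoid_scheme \<Rightarrow> real \<Rightarrow> 'a pmf \<Rightarrow> ('a \<Rightarrow> real) \<Rightarrow> ennreal" where
  "energy G p \<phi> f =
     ennreal (1 / 2) * (\<Sum>\<^sub>\<infinity>(x, y)\<in>carrier G \<times> carrier G.
       ennreal (\<bar>f (x \<otimes>\<^bsub>G\<^esub> y) - f x\<bar> powr p * pmf \<phi> y))"

definition support_on :: "('a, 'm) monoid_scheme \<Rightarrow> ('a \<Rightarrow> real) \<Rightarrow> 'a set" where
  "support_on G f = {x \<in> carrier G. f x \<noteq> 0}"

definition lp_norm :: "('a, 'm) monoid_scheme \<Rightarrow> real \<Rightarrow> ('a \<Rightarrow> real) \<Rightarrow> real" where
  "lp_norm G p f = (\<Sum>\<^sub>\<infinity>x\<in>carrier G. \<bar>f x\<bar> powr p) powr (1 / p)"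

definition spectral_profile :: "('a, 'm) monoid_scheme \<Rightarrow> real \<Rightarrow> 'a pmf \<Rightarrow> real \<Rightarrow> ennreal" where
  "spectral_profile G p \<phi> v =
     Inf {energy G p \<phi> f | f. finite (support_on G f) \<and> real (card (support_on G f)) \<le> v
                             \<and> lp_norm G p f = 1}"

definition convolution :: "('a, 'm) monoid_scheme \<Rightarrow> 'a pmf \<Rightarrow> 'a pmf \<Rightarrow> 'a pmf" where
  "convolution G \<phi> \<psi> = bind_pmf \<phi> (\<lambda>x. map_pmf (\<lambda>y. x \<otimes>\<^bsub>G\<^esub> y) \<psi>)"

primrec conv_power :: "('a, 'm) monoid_scheme \<Rightarrow> 'a pmf \<Rightarrow> nat \<Rightarrow> 'a pmf" where
  "conv_power G \<mu> 0 = return_pmf \<one>\<^bsub>G\<^esub>"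
| "conv_power G \<mu> (Suc n) = convolution G (conv_power G \<mu> n) \<mu>"

text \<open>The convention \<open>0 log 0 = 0\<close> is built in.\<close>

definition entropy_at :: "('a, 'm) monoid_scheme \<Rightarrow> 'a pmf \<Rightarrow> nat \<Rightarrow> ennreal" where
  "entropy_at G \<mu> n =
     (\<Sum>\<^sub>\<infinity>g\<in>carrier G. ennreal (- ln (pmf (conv_power G \<mu> n) g) * pmf (conv_power G \<mu> n) g))"

definition drift_at :: "('a, 'm) monoid_scheme \<Rightarrow> 'a list \<Rightarrow> 'a pmf \<Rightarrow> nat \<Rightarrow> ennreal" where
  "drift_at G S \<mu> n =
     (\<Sum>\<^sub>\<infinity>g\<in>carrier G. ennreal (real (word_length G S g) * pmf (conv_power G \<mu> n) g))"

definition finite_moment :: "('a, 'm) monoid_scheme \<Rightarrow> 'a list \<Rightarrow> real \<Rightarrow> 'a pmf \<Rightarrow> bool" where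
  "finite_moment G S p \<mu> \<longleftrightarrow>
     (\<lambda>g. real (word_length G S g) powr p * pmf \<mu> g) summable_on carrier G"

text \<open>
  Only the values on \<open>[1, \<infinity>)\<close> matter. Measurability, often part of the definition of slow
  variation, is automatic for the monotone functions considered here.
\<close>

definition slowly_varying :: "(real \<Rightarrow> real) \<Rightarrow> bool" where
  "slowly_varying f \<longleftrightarrow>
     (\<forall>x\<ge>1. f x > 0) \<and> (\<forall>c>0. ((\<lambda>x. f (c * x) / f x) \<longlongrightarrow> 1) at_top)"

end

theory Submission
  imports Defs
begin

text \<open>
  Everything is reduced to two facts: the walk stays, up to a small probability, in sets of
  controlled size, and the speed at which its distance to the identity grows is controlled by the
  entropy that it gains.

  \<^bold>\<open>Entropy.\<close> Let \<open>f\<close> nearly attain the profile at volume \<open>v\<close>. Then \<open>h = \<bar>f\<bar> powr (p / 2)\<close> is a unit vector in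
  \<open>\<ell>\<^sup>2\<close>, and \<open>\<bar>\<bar>a\<bar> powr (p / 2) - \<bar>b\<bar> powr (p / 2)\<bar>\<^sup>2 \<le> \<bar>a - b\<bar> powr p\<close> together with the pseudo-Poincare
  inequality (\<open>shift_diff_le\<close>) shows that translating \<open>h\<close> by \<open>g\<close> decreases the correlation with \<open>h\<close> by
  at most a constant times the product of \<open>\<bar>g\<bar> powr p\<close> and the energy of \<open>f\<close>. By the moment condition the mean
  decrease \<open>1 - \<langle>h, P h\<rangle>\<close> under one step of the walk is bounded by the energy, and since the walk is
  symmetric, \<open>n\<close> steps lose at most \<open>n\<close> times as much (\<open>corr_walk_ge\<close>). On the other hand, the
  correlations of \<open>h\<close> with all its translates add up to at most \<open>v\<close>, so at most \<open>2 v\<close> translates have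
  correlation at least one half. Hence (\<open>good_set_of_function\<close>) the walk at time \<open>n\<close> lies in a fixed
  set of size at most \<open>2 v\<close>, except with probability of order \<open>n * \<l> (ln v) / ln v powr (1 / \<alpha>)\<close>.
  This is used at the volumes with \<open>ln v = 2 ^ j * R\<close>, where \<open>R\<close> is of order \<open>n powr \<alpha> * \<omega> n\<close>. The
  condition on \<open>\<omega>\<close> makes the exceptional probabilities at most of order \<open>2 powr (- b * j)\<close> with
  \<open>b > 1\<close>, whereas the logarithms of the volumes grow only like \<open>2 ^ j\<close>, so the entropy is of order
  \<open>R\<close> (\<open>entropy_finite_sum_le\<close>).

  \<^bold>\<open>Drift.\<close> The entropy gained in one step is at least half of the mean squared \<open>\<ell>\<^sup>2\<close> distance between the
  square roots of two random translates of the current distribution (\<open>ent_convolution_ge\<close>). Since word length is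
  Lipschitz, the drift gained in two steps is at most the mean of the displacement times the
  difference of two such translates, and a weighted Young inequality bounds this by the Hellinger term
  and a moment of \<open>\<mu>\<close> of order \<open>2 / (3 - p) \<le> p\<close> (\<open>drift_two_steps_le\<close>). Summing over time, with the
  weight chosen according to the entropy bound, gives the drift bound.
\<close>

section \<open>Sums over discrete spaces\<close>

lemma nn_integral_pmf_count_space_swap:
  "(\<integral>\<^sup>+x. \<integral>\<^sup>+s. f x s \<partial>measure_pmf \<mu> \<partial>count_space A) = (\<integral>\<^sup>+s. \<integral>\<^sup>+x. f x s \<partial>count_space A \<partial>measure_pmf \<mu>)"
proof -
  have *: "(\<integral>\<^sup>+s. g s \<partial>measure_pmf \<mu>) = (\<integral>\<^sup>+s. ennreal (pmf \<mu> s) * g s \<partial>count_space (set_pmf \<mu>))"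
    for g :: "'b \<Rightarrow> ennreal"
    unfolding nn_integral_measure_pmf
    by (rule nn_integral_count_space_eq) (auto simp: set_pmf_iff)
  show ?thesis
    unfolding *
    by (subst nn_integral_count_space_nn_integral)
       (auto intro!: nn_integral_cong simp: nn_integral_cmult)
qed

lemma nn_integral_count_space_eq_infsum:
  fixes f :: "'a \<Rightarrow> ennreal"
  shows "(\<integral>\<^sup>+x. f x \<partial>count_space A) = (\<Sum>\<^sub>\<infinity>x\<in>A. f x)"
proof (rule antisym)
  have summ: "f summable_on A" by (rule nonneg_summable_on_complete) auto
  show "(\<Sum>\<^sub>\<infinity>x\<in>A. f x) \<le> (\<integral>\<^sup>+x. f x \<partial>count_space A)"
  proof (rule infsum_le_finite_sums[OF summ])
    fix F assume F: "finite F" "F \<subseteq> A"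
    have "sum f F = (\<integral>\<^sup>+x. f x \<partial>count_space F)"
      using F by (simp add: nn_integral_count_space_finite)
    also have "\<dots> = (\<integral>\<^sup>+x. f x * indicator F x \<partial>count_space A)"
      using F by (subst (1 2) nn_integral_count_space_indicator)
        (auto intro!: nn_integral_cong simp: indicator_def)
    also have "\<dots> \<le> (\<integral>\<^sup>+x. f x \<partial>count_space A)"
      by (intro nn_integral_mono) (auto simp: indicator_def)
    finally show "sum f F \<le> (\<integral>\<^sup>+x. f x \<partial>count_space A)" .
  qed
  show "(\<integral>\<^sup>+x. f x \<partial>count_space A) \<le> (\<Sum>\<^sub>\<infinity>x\<in>A. f x)"
  proof (cases "(\<Sum>\<^sub>\<infinity>x\<in>A. f x) = \<top>")
    case False
    define B where "B = (\<Sum>\<^sub>\<infinity>x\<in>A. f x)"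
    have Bfin: "B < \<top>" using False by (simp add: B_def less_top)
    have fin: "sum f F \<le> B" if "finite F" "F \<subseteq> A" for F
      unfolding B_def using that
      by (subst nonneg_infsum_complete) (auto intro!: SUP_upper)
    define g where "g x = enn2real (f x)" for x
    have fx: "f x = ennreal (g x)" if "x \<in> A" for x
    proof -
      have "f x \<le> B" using fin[of "{x}"] that by simp
      then show ?thesis using Bfin by (simp add: g_def)
    qed
    have sg: "sum g F \<le> enn2real B" if "finite F" "F \<subseteq> A" for F
    proof -
      have "ennreal (sum g F) = (\<Sum>x\<in>F. ennreal (g x))"
        by (rule sum_ennreal[symmetric]) (simp add: g_def)
      also have "\<dots> = sum f F"
        using that(2) by (intro sum.cong refl fx[symmetric]) auto
      finally have "ennreal (sum g F) = sum f F" .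
      then show ?thesis using fin[OF that] Bfin
        by (metis enn2real_ennreal enn2real_mono enn2real_nonneg g_def sum_nonneg)
    qed
    have gs: "g summable_on A"
      by (rule nonneg_bdd_above_summable_on) (auto simp: g_def intro!: bdd_aboveI[of _ "enn2real B"] sg[unfolded g_def])
    moreover have "(\<lambda>x. norm (g x)) = g" by (simp add: g_def fun_eq_iff)
    ultimately have "(\<lambda>x. norm (g x)) summable_on A" by simp
    note ga = iffD1[OF abs_summable_equivalent this]
    have "(\<integral>\<^sup>+x. f x \<partial>count_space A) = (\<integral>\<^sup>+x. ennreal (g x) \<partial>count_space A)"
      by (intro nn_integral_cong) (auto simp: fx)
    also have "\<dots> = ennreal (infsetsum g A)"
      by (rule nn_integral_conv_infsetsum[OF ga]) (simp add: g_def)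
    also have "\<dots> = ennreal (infsum g A)" by (simp add: infsetsum_infsum[OF ga])
    also have "\<dots> \<le> ennreal (enn2real B)"
      by (intro ennreal_leI infsum_le_finite_sums[OF gs] sg)
    also have "\<dots> = B" using Bfin by simp
    finally show ?thesis by (simp add: B_def)
  qed simp
qed


section \<open>Correlation of probability mass functions\<close>

text \<open>
  The inner product of \<open>\<pi>\<close> and \<open>\<rho>\<close> in \<open>\<ell>\<^sup>2\<close>, equivalently the
  probability that independent samples of \<open>\<pi>\<close> and \<open>\<rho>\<close> coincide. Working with mass functions
  only keeps every sum absolutely convergent.
\<close>

definition corr :: "'a pmf \<Rightarrow> 'a pmf \<Rightarrow> real" where
  "corr \<pi> \<rho> = (\<integral>x. pmf \<pi> x * pmf \<rho> x \<partial>count_space UNIV)"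

lemma integrable_pmf_mult: "integrable (count_space UNIV) (\<lambda>x. pmf \<pi> x * pmf \<rho> x)"
proof (rule Bochner_Integration.integrable_bound[where f = "pmf \<pi>"])
  show "AE x in count_space UNIV. norm (pmf \<pi> x * pmf \<rho> x) \<le> norm (pmf \<pi> x)"
    by (auto intro!: AE_I2 mult_left_le simp: abs_mult pmf_le_1)
qed (auto intro: integrable_pmf)

lemma ennreal_corr: "ennreal (corr \<pi> \<rho>) = (\<integral>\<^sup>+x. ennreal (pmf \<pi> x * pmf \<rho> x) \<partial>count_space UNIV)"
  unfolding corr_def by (rule nn_integral_eq_integral[symmetric]) (auto intro: integrable_pmf_mult)

lemma corr_commute: "corr \<pi> \<rho> = corr \<rho> \<pi>"
  by (simp add: corr_def mult.commute)

lemma corr_nonneg [simp]: "0 \<le> corr \<pi> \<rho>"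
  by (simp add: corr_def)

lemma corr_le_1: "corr \<pi> \<rho> \<le> 1"
proof -
  have "ennreal (corr \<pi> \<rho>) \<le> (\<integral>\<^sup>+x. ennreal (pmf \<pi> x) \<partial>count_space UNIV)"
    unfolding ennreal_corr
    by (intro nn_integral_mono ennreal_leI) (simp add: mult_left_le pmf_le_1)
  also have "\<dots> = 1" by (simp add: nn_integral_pmf)
  finally show ?thesis by simp
qed

lemma integrable_corr: "integrable (measure_pmf \<mu>) (\<lambda>y. corr (f y) (g y))"
  by (rule measure_pmf.integrable_const_bound[of _ 1]) (auto simp: corr_le_1)

lemma corr_bind:
  "corr \<rho> (bind_pmf \<mu> k) = (\<integral>y. corr \<rho> (k y) \<partial>measure_pmf \<mu>)"
proof -
  have "ennreal (corr \<rho> (bind_pmf \<mu> k)) = (\<integral>\<^sup>+x. \<integral>\<^sup>+y. ennreal (pmf \<rho> x * pmf (k y) x) \<partial>measure_pmf \<mu> \<partial>count_space UNIV)"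
    unfolding ennreal_corr
    by (intro nn_integral_cong) (simp add: ennreal_mult ennreal_pmf_bind nn_integral_cmult)
  also have "\<dots> = (\<integral>\<^sup>+y. ennreal (corr \<rho> (k y)) \<partial>measure_pmf \<mu>)"
    by (simp add: nn_integral_pmf_count_space_swap ennreal_corr)
  also have "\<dots> = ennreal (\<integral>y. corr \<rho> (k y) \<partial>measure_pmf \<mu>)"
    by (rule nn_integral_eq_integral) (auto intro: integrable_corr)
  finally show ?thesis by (simp add: integral_nonneg)
qed

lemma corr_diff_nonneg: "2 * corr \<pi> \<rho> \<le> corr \<pi> \<pi> + corr \<rho> \<rho>"
proof -
  have "0 \<le> (\<integral>x. (pmf \<pi> x - pmf \<rho> x)\<^sup>2 \<partial>count_space UNIV)" by simp
  also have "\<dots> = (\<integral>x. pmf \<pi> x * pmf \<pi> x - 2 * (pmf \<pi> x * pmf \<rho> x) + pmf \<rho> x * pmf \<rho> x \<partial>count_space UNIV)"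
    by (simp add: power2_eq_square algebra_simps)
  also have "\<dots> = corr \<pi> \<pi> - 2 * corr \<pi> \<rho> + corr \<rho> \<rho>"
    by (simp add: corr_def integrable_pmf_mult)
  finally show ?thesis by simp
qed


text \<open>
  Expansion of \<open>\<parallel>(\<pi> - \<rho>) + (\<pi>' - \<rho>')\<parallel>\<^sup>2 \<ge> 0\<close>. With \<open>\<pi>'\<close> and \<open>\<rho>'\<close> translates of
  \<open>\<pi>\<close> and \<open>\<rho>\<close>, averaging this over the translation says that the Markov operator is bounded
  below by \<open>-1\<close> on the vector \<open>\<pi> - \<rho>\<close>.
\<close>

lemma corr_diff_sum_nonneg:
  "0 \<le> corr \<pi> \<pi> + corr \<rho> \<rho> + corr \<pi>' \<pi>' + corr \<rho>' \<rho>'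
     - 2 * corr \<pi> \<rho> - 2 * corr \<pi>' \<rho>' + 2 * corr \<pi> \<pi>' + 2 * corr \<rho> \<rho>'
     - 2 * corr \<pi> \<rho>' - 2 * corr \<rho> \<pi>'"
proof -
  let ?a = "pmf \<pi>" and ?b = "pmf \<rho>" and ?c = "pmf \<pi>'" and ?d = "pmf \<rho>'"
  have "0 \<le> (\<integral>x. (?a x - ?b x + ?c x - ?d x)\<^sup>2 \<partial>count_space UNIV)" by simp
  also have "\<dots> = (\<integral>x. ?a x * ?a x + ?b x * ?b x + ?c x * ?c x + ?d x * ?d x
      - 2 * (?a x * ?b x) - 2 * (?c x * ?d x) + 2 * (?a x * ?c x) + 2 * (?b x * ?d x)
      - 2 * (?a x * ?d x) - 2 * (?b x * ?c x) \<partial>count_space UNIV)"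
    by (intro Bochner_Integration.integral_cong) (auto simp: power2_eq_square algebra_simps)
  also have "\<dots> = corr \<pi> \<pi> + corr \<rho> \<rho> + corr \<pi>' \<pi>' + corr \<rho>' \<rho>'
     - 2 * corr \<pi> \<rho> - 2 * corr \<pi>' \<rho>' + 2 * corr \<pi> \<pi>' + 2 * corr \<rho> \<rho>'
     - 2 * corr \<pi> \<rho>' - 2 * corr \<rho> \<pi>'"
    by (simp add: corr_def integrable_pmf_mult)
  finally show ?thesis .
qed


section \<open>Slow decorrelation of symmetric walks\<close>

definition right_shift :: "('a, 'm) monoid_scheme \<Rightarrow> 'a pmf \<Rightarrow> 'a \<Rightarrow> 'a pmf" where
  "right_shift G \<pi> y = map_pmf (\<lambda>x. x \<otimes>\<^bsub>G\<^esub> y) \<pi>"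

lemma convolution_eq_bind_shift: "convolution G \<pi> \<mu> = bind_pmf \<mu> (right_shift G \<pi>)"
  unfolding convolution_def right_shift_def map_pmf_def by (subst bind_commute_pmf) simp

context group begin

lemma set_shift: "set_pmf \<pi> \<subseteq> carrier G \<Longrightarrow> y \<in> carrier G \<Longrightarrow> set_pmf (right_shift G \<pi> y) \<subseteq> carrier G"
  by (auto simp: right_shift_def)

lemma set_convolution:
  "set_pmf \<pi> \<subseteq> carrier G \<Longrightarrow> set_pmf \<rho> \<subseteq> carrier G \<Longrightarrow> set_pmf (convolution G \<pi> \<rho>) \<subseteq> carrier G"
  by (fastforce simp: convolution_def)

lemma set_conv_power: "set_pmf \<mu> \<subseteq> carrier G \<Longrightarrow> set_pmf (conv_power G \<mu> n) \<subseteq> carrier G"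
  by (induction n) (auto dest: set_convolution)

lemma pmf_shift:
  assumes "set_pmf \<pi> \<subseteq> carrier G" "y \<in> carrier G" "x \<in> carrier G"
  shows "pmf (right_shift G \<pi> y) x = pmf \<pi> (x \<otimes> inv y)"
proof -
  have "(\<lambda>z. z \<otimes> y) -` {x} \<inter> set_pmf \<pi> = {x \<otimes> inv y} \<inter> set_pmf \<pi>"
    using assms by (auto simp: inv_solve_right' m_assoc)
  then have "measure \<pi> ((\<lambda>z. z \<otimes> y) -` {x}) = measure \<pi> {x \<otimes> inv y}"
    by (metis measure_Int_set_pmf)
  then show ?thesis
    by (simp add: right_shift_def pmf_map pmf.rep_eq)
qed

lemma pmf_outside: "set_pmf \<pi> \<subseteq> carrier G \<Longrightarrow> x \<notin> carrier G \<Longrightarrow> pmf \<pi> x = 0"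
  by (auto simp: set_pmf_iff)

lemma shift_shift:
  assumes "set_pmf \<pi> \<subseteq> carrier G" "y \<in> carrier G" "z \<in> carrier G"
  shows "right_shift G (right_shift G \<pi> y) z = right_shift G \<pi> (y \<otimes> z)"
  using assms by (auto simp: right_shift_def pmf.map_comp o_def m_assoc subset_iff intro!: map_pmf_cong)

lemma shift_one: "set_pmf \<pi> \<subseteq> carrier G \<Longrightarrow> right_shift G \<pi> \<one> = \<pi>"
  unfolding right_shift_def
  by (rule trans[OF map_pmf_cong[where g="\<lambda>x. x"]]) (auto simp: subset_iff)

lemma bij_betw_right_mult: "y \<in> carrier G \<Longrightarrow> bij_betw (\<lambda>x. x \<otimes> y) (carrier G) (carrier G)"
  by (rule bij_betwI[where g="\<lambda>x. x \<otimes> inv y"]) (auto simp: m_assoc)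

lemma corr_carrier:
  assumes "set_pmf \<pi> \<subseteq> carrier G"
  shows "ennreal (corr \<pi> \<rho>) = (\<integral>\<^sup>+x. ennreal (pmf \<pi> x * pmf \<rho> x) \<partial>count_space (carrier G))"
  unfolding ennreal_corr using assms
  by (intro nn_integral_count_space_eq) (auto simp: set_pmf_iff)

lemma corr_shift_shift:
  assumes "set_pmf \<pi> \<subseteq> carrier G" "set_pmf \<rho> \<subseteq> carrier G" "y \<in> carrier G"
  shows "corr (right_shift G \<pi> y) (right_shift G \<rho> y) = corr \<pi> \<rho>"
proof -
  have "ennreal (corr (right_shift G \<pi> y) (right_shift G \<rho> y)) =
    (\<integral>\<^sup>+x. ennreal (pmf (right_shift G \<pi> y) (x \<otimes> y) * pmf (right_shift G \<rho> y) (x \<otimes> y)) \<partial>count_space (carrier G))"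
    by (subst corr_carrier[OF set_shift[OF assms(1,3)]])
       (rule nn_integral_bij_count_space[OF bij_betw_right_mult[OF assms(3)], symmetric])
  also have "\<dots> = (\<integral>\<^sup>+x. ennreal (pmf \<pi> x * pmf \<rho> x) \<partial>count_space (carrier G))"
    using assms by (intro nn_integral_cong) (auto simp: pmf_shift m_assoc)
  finally show ?thesis using assms by (simp add: corr_carrier[symmetric])
qed

lemma corr_shift_left:
  assumes "set_pmf \<pi> \<subseteq> carrier G" "set_pmf \<rho> \<subseteq> carrier G" "y \<in> carrier G"
  shows "corr (right_shift G \<pi> y) \<rho> = corr \<pi> (right_shift G \<rho> (inv y))"
  using corr_shift_shift[of "right_shift G \<pi> y" \<rho> "inv y"] assms
  by (simp add: set_shift shift_shift shift_one)

lemma corr_convolution: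
  "corr \<rho> (convolution G \<pi> \<mu>) = (\<integral>y. corr \<rho> (right_shift G \<pi> y) \<partial>measure_pmf \<mu>)"
  by (simp add: convolution_eq_bind_shift corr_bind)

lemma symmetric_measure_map_inv:
  assumes "symmetric_measure G \<mu>"
  shows "map_pmf (\<lambda>g. inv g) \<mu> = \<mu>"
proof (rule pmf_eqI)
  fix x
  have sub: "set_pmf \<mu> \<subseteq> carrier G" and sy: "\<And>g. g \<in> carrier G \<Longrightarrow> pmf \<mu> (inv g) = pmf \<mu> g"
    using assms by (auto simp: symmetric_measure_def)
  show "pmf (map_pmf (\<lambda>g. inv g) \<mu>) x = pmf \<mu> x"
  proof (cases "x \<in> carrier G")
    case True
    have "(\<lambda>g. inv g) -` {x} \<inter> set_pmf \<mu> = {inv x} \<inter> set_pmf \<mu>"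
      using sub True by auto
    then have "measure \<mu> ((\<lambda>g. inv g) -` {x}) = measure \<mu> {inv x}"
      by (metis measure_Int_set_pmf)
    then show ?thesis using sy[OF True] by (simp add: pmf_map pmf.rep_eq)
  next
    case False
    then have "x \<notin> set_pmf (map_pmf (\<lambda>g. inv g) \<mu>)" using sub by auto
    then show ?thesis using False sub by (metis pmf_outside set_pmf_iff)
  qed
qed


text \<open>
  The Markov operator \<open>P\<close> of right convolution by \<open>\<mu>\<close> averages right translations. These are
  isometries, and the adjoint of translation by \<open>y\<close> is translation by \<open>inv y\<close>, so symmetry of
  \<open>\<mu>\<close> makes \<open>P\<close> self-adjoint.
\<close>

lemma corr_convolution_adjoint:
  assumes "symmetric_measure G \<mu>" "set_pmf \<pi> \<subseteq> carrier G" "set_pmf \<rho> \<subseteq> carrier G"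
  shows "corr (convolution G \<pi> \<mu>) \<rho> = corr \<pi> (convolution G \<rho> \<mu>)"
proof -
  have sub: "set_pmf \<mu> \<subseteq> carrier G" using assms by (simp add: symmetric_measure_def)
  have "corr (convolution G \<pi> \<mu>) \<rho> = (\<integral>y. corr (right_shift G \<pi> y) \<rho> \<partial>measure_pmf \<mu>)"
    by (subst (1 2) corr_commute) (simp add: corr_convolution)
  also have "\<dots> = (\<integral>y. corr \<pi> (right_shift G \<rho> (inv y)) \<partial>measure_pmf \<mu>)"
    using assms sub by (intro integral_cong_AE) (auto simp: AE_measure_pmf_iff corr_shift_left subset_iff)
  also have "\<dots> = (\<integral>y. corr \<pi> (right_shift G \<rho> y) \<partial>measure_pmf (map_pmf (\<lambda>g. inv g) \<mu>))"
    by simp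
  also have "\<dots> = corr \<pi> (convolution G \<rho> \<mu>)"
    by (simp only: symmetric_measure_map_inv[OF assms(1)] corr_convolution)
  finally show ?thesis .
qed

text \<open>
  The law of the walk after \<open>n\<close> steps when it starts from a random point with law \<open>q\<close>, which is
  \<open>P\<^sup>n q\<close> for the Markov operator \<open>P\<close>.
\<close>

primrec walk :: "'a pmf \<Rightarrow> 'a pmf \<Rightarrow> nat \<Rightarrow> 'a pmf" where
  "walk q \<mu> 0 = q"
| "walk q \<mu> (Suc n) = convolution G (walk q \<mu> n) \<mu>"

lemma set_walk: "set_pmf q \<subseteq> carrier G \<Longrightarrow> set_pmf \<mu> \<subseteq> carrier G \<Longrightarrow> set_pmf (walk q \<mu> n) \<subseteq> carrier G"
  by (induction n) (auto dest: set_convolution)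

lemma convolution_assoc:
  assumes "set_pmf \<pi> \<subseteq> carrier G" "set_pmf \<rho> \<subseteq> carrier G" "set_pmf \<sigma> \<subseteq> carrier G"
  shows "convolution G (convolution G \<pi> \<rho>) \<sigma> = convolution G \<pi> (convolution G \<rho> \<sigma>)"
  using assms unfolding convolution_def
  by (auto simp: bind_assoc_pmf bind_map_pmf map_bind_pmf pmf.map_comp o_def m_assoc subset_iff
      intro!: bind_pmf_cong map_pmf_cong)

lemma walk_eq_convolution:
  assumes "set_pmf q \<subseteq> carrier G" "set_pmf \<mu> \<subseteq> carrier G"
  shows "walk q \<mu> n = convolution G q (conv_power G \<mu> n)"
proof (induction n)
  case 0
  have "convolution G q (return_pmf \<one>) = right_shift G q \<one>"
    by (simp add: convolution_def right_shift_def map_pmf_def bind_return_pmf)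
  then show ?case using assms by (simp add: shift_one)
next
  case (Suc n)
  then show ?case using assms by (simp add: convolution_assoc set_conv_power)
qed

lemma corr_walk_shift:
  assumes "symmetric_measure G \<mu>" "set_pmf q \<subseteq> carrier G"
  shows "corr (walk q \<mu> (Suc j)) (walk q \<mu> k) = corr (walk q \<mu> j) (walk q \<mu> (Suc k))"
proof -
  have "set_pmf \<mu> \<subseteq> carrier G" using assms(1) by (simp add: symmetric_measure_def)
  then show ?thesis
    using corr_convolution_adjoint[OF assms(1) set_walk[OF assms(2)] set_walk[OF assms(2)]] by simp
qed

lemma corr_walk:
  assumes "symmetric_measure G \<mu>" "set_pmf q \<subseteq> carrier G"
  shows "corr (walk q \<mu> j) (walk q \<mu> k) = corr q (walk q \<mu> (j + k))"
proof (induction j arbitrary: k)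
  case (Suc j)
  then show ?case by (simp only: corr_walk_shift[OF assms]) simp
qed simp


text \<open>
  Put \<open>a k = \<langle>q, P\<^sup>k q\<rangle>\<close>, \<open>u = P\<^sup>j q\<close> and \<open>w = u - P u\<close>. Since \<open>P\<close> is self-adjoint,
  the difference of the two sides is \<open>\<langle>w, w\<rangle>\<close> in the first inequality and
  \<open>\<langle>w, w\<rangle> + \<langle>w, P w\<rangle>\<close> in the second, and the latter is nonnegative because \<open>P\<close> is an average of
  isometries. Consecutive decrements of \<open>a\<close> need not be monotone from odd to even indices, which is
  why both are compared with the preceding even one.
\<close>

lemma corr_walk_decrements:
  assumes sym: "symmetric_measure G \<mu>" and q: "set_pmf q \<subseteq> carrier G"
  defines "a \<equiv> \<lambda>k. corr q (walk q \<mu> k)"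
  shows "a (2 * j + 1) - a (2 * j + 2) \<le> a (2 * j) - a (2 * j + 1)"
    and "a (2 * j + 2) - a (2 * j + 3) \<le> a (2 * j) - a (2 * j + 1)"
proof -
  have mu: "set_pmf \<mu> \<subseteq> carrier G" using sym by (simp add: symmetric_measure_def)
  let ?\<pi> = "walk q \<mu> j" and ?\<rho> = "walk q \<mu> (Suc j)"
  have eq: "corr ?\<pi> ?\<pi> = a (2 * j)" "corr ?\<pi> ?\<rho> = a (2 * j + 1)" "corr ?\<rho> ?\<rho> = a (2 * j + 2)"
    by (simp_all only: corr_walk[OF sym q] a_def) (simp_all add: mult_2 numeral_eq_Suc del: walk.simps)
  show "a (2 * j + 1) - a (2 * j + 2) \<le> a (2 * j) - a (2 * j + 1)"
    using corr_diff_nonneg[of ?\<pi> ?\<rho>] unfolding eq by simp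
  have sets: "set_pmf ?\<pi> \<subseteq> carrier G" "set_pmf ?\<rho> \<subseteq> carrier G"
    using set_walk[OF q mu] by blast+
  have *: "0 \<le> 2 * a (2 * j) + 2 * a (2 * j + 2) - 4 * a (2 * j + 1)
      + 2 * corr ?\<pi> (right_shift G ?\<pi> y) + 2 * corr ?\<rho> (right_shift G ?\<rho> y)
      - 2 * corr ?\<pi> (right_shift G ?\<rho> y) - 2 * corr ?\<rho> (right_shift G ?\<pi> y)" if "y \<in> carrier G" for y
    using corr_diff_sum_nonneg[of ?\<pi> ?\<rho> "right_shift G ?\<pi> y" "right_shift G ?\<rho> y"]
    unfolding corr_shift_shift[OF sets(1) sets(1) that] corr_shift_shift[OF sets(1) sets(2) that]
        corr_shift_shift[OF sets(2) sets(2) that] eq by linarith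
  have "0 \<le> (\<integral>y. 2 * a (2 * j) + 2 * a (2 * j + 2) - 4 * a (2 * j + 1)
      + 2 * corr ?\<pi> (right_shift G ?\<pi> y) + 2 * corr ?\<rho> (right_shift G ?\<rho> y)
      - 2 * corr ?\<pi> (right_shift G ?\<rho> y) - 2 * corr ?\<rho> (right_shift G ?\<pi> y) \<partial>measure_pmf \<mu>)"
    by (intro integral_nonneg_AE) (use mu * in \<open>auto simp: AE_measure_pmf_iff\<close>)
  also have "\<dots> = 2 * a (2 * j) + 2 * a (2 * j + 2) - 4 * a (2 * j + 1)
      + 2 * corr ?\<pi> ?\<rho> + 2 * corr ?\<rho> (walk q \<mu> (Suc (Suc j)))
      - 2 * corr ?\<pi> (walk q \<mu> (Suc (Suc j))) - 2 * corr ?\<rho> ?\<rho>"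
    by (simp add: integrable_corr corr_convolution[symmetric])
  also have "corr ?\<rho> (walk q \<mu> (Suc (Suc j))) = a (2 * j + 3)"
    by (simp only: corr_walk[OF sym q] a_def) (simp add: mult_2 numeral_eq_Suc del: walk.simps)
  also have "corr ?\<pi> (walk q \<mu> (Suc (Suc j))) = a (2 * j + 2)"
    by (simp only: corr_walk[OF sym q] a_def) (simp add: mult_2 numeral_eq_Suc del: walk.simps)
  finally show "a (2 * j + 2) - a (2 * j + 3) \<le> a (2 * j) - a (2 * j + 1)"
    unfolding eq by simp
qed


text \<open>
  In spectral terms this is \<open>1 - \<lambda>\<^sup>n \<le> n (1 - \<lambda>)\<close> on \<open>[-1, 1]\<close>; here it follows by
  telescoping, every decrement being at most the first one.
\<close>

lemma corr_walk_ge: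
  assumes sym: "symmetric_measure G \<mu>" and q: "set_pmf q \<subseteq> carrier G"
  shows "corr q q - corr q (walk q \<mu> n) \<le> real n * (corr q q - corr q (convolution G q \<mu>))"
proof -
  define a where "a k = corr q (walk q \<mu> k)" for k
  note dec = corr_walk_decrements[OF sym q, folded a_def]
  have even: "a (2 * j) - a (2 * j + 1) \<le> a 0 - a 1" for j
  proof (induction j)
    case (Suc j)
    then show ?case using dec(2)[of j] by (simp add: numeral_eq_Suc)
  qed simp
  have step: "a k - a (Suc k) \<le> a 0 - a 1" for k
  proof (cases "even k")
    case True
    then show ?thesis using even[of "k div 2"] by simp
  next
    case False
    then obtain j where "k = 2 * j + 1" by (rule oddE)
    then show ?thesis using dec(1)[of j] even[of j] by (simp add: numeral_eq_Suc)
  qed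
  have "a 0 - a n \<le> real n * (a 0 - a 1)"
  proof (induction n)
    case (Suc n)
    then show ?case using step[of n] by (simp add: algebra_simps)
  qed simp
  then show ?thesis by (simp add: a_def)
qed

end

section \<open>Power inequalities\<close>

lemma powr_subadditive:
  fixes x y r :: real
  assumes "0 \<le> x" "0 \<le> y" "0 < r" "r \<le> 1"
  shows "(x + y) powr r \<le> x powr r + y powr r"
proof (cases "x + y = 0")
  case False
  then have s: "x + y > 0" using assms by simp
  have le: "t \<le> t powr r" if "0 \<le> t" "t \<le> 1" for t :: real
    using that assms by (cases "t = 0") (auto intro: powr_mono'[of r 1 t, simplified] simp: powr_mono'[of r 1 t, simplified])
  have "1 = x / (x + y) + y / (x + y)" using s by (simp add: add_divide_distrib[symmetric])
  also have "\<dots> \<le> (x / (x + y)) powr r + (y / (x + y)) powr r"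
    using assms s by (intro add_mono le) auto
  also have "\<dots> = (x powr r + y powr r) / (x + y) powr r"
    using assms by (simp add: powr_divide add_divide_distrib)
  finally show ?thesis using s by (simp add: field_simps)
qed (use assms in auto)


text \<open>
  This is what turns the \<open>p\<close>-energy of \<open>f\<close> into a bound for the quadratic energy of
  \<open>\<bar>f\<bar> powr (p / 2)\<close>.
\<close>

lemma powr_half_diff_square_le:
  fixes a b p :: real
  assumes "0 < p" "p \<le> 2"
  shows "(\<bar>a\<bar> powr (p / 2) - \<bar>b\<bar> powr (p / 2))\<^sup>2 \<le> \<bar>a - b\<bar> powr p"
proof -
  have *: "\<bar>a\<bar> powr (p / 2) - \<bar>b\<bar> powr (p / 2) \<le> \<bar>a - b\<bar> powr (p / 2)" for a b :: real
  proof -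
    have "\<bar>a\<bar> powr (p / 2) \<le> (\<bar>b\<bar> + \<bar>a - b\<bar>) powr (p / 2)"
      using assms by (intro powr_mono2) auto
    also have "\<dots> \<le> \<bar>b\<bar> powr (p / 2) + \<bar>a - b\<bar> powr (p / 2)"
      using assms by (intro powr_subadditive) auto
    finally show ?thesis by simp
  qed
  have "\<bar>\<bar>a\<bar> powr (p / 2) - \<bar>b\<bar> powr (p / 2)\<bar> \<le> \<bar>a - b\<bar> powr (p / 2)"
    using *[of a b] *[of b a] by (simp add: abs_minus_commute abs_le_iff)
  then have "(\<bar>a\<bar> powr (p / 2) - \<bar>b\<bar> powr (p / 2))\<^sup>2 \<le> (\<bar>a - b\<bar> powr (p / 2))\<^sup>2"
    by (metis abs_ge_zero power2_abs power_mono)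
  also have "\<dots> = \<bar>a - b\<bar> powr p"
    by (simp add: power2_eq_square powr_add[symmetric])
  finally show ?thesis .
qed


text \<open>
  Convexity with weights \<open>k / (k + 1)\<close> and \<open>1 / (k + 1)\<close>. If \<open>a\<close> is the total of \<open>k\<close> increments
  and \<open>b\<close> is one more, induction on this inequality yields the power mean inequality for a sum of
  \<open>k\<close> terms with the sharp factor \<open>k powr (p - 1)\<close>.
\<close>

lemma powr_add_le_weighted:
  fixes a b k p :: real
  assumes "0 \<le> a" "0 \<le> b" "1 \<le> k" "1 \<le> p"
  shows "(a + b) powr p \<le> (k + 1) powr (p - 1) * (a powr p / k powr (p - 1) + b powr p)"
proof -
  have conv: "(k / (k + 1) * x + 1 / (k + 1) * y) powr p \<le> k / (k + 1) * x powr p + 1 / (k + 1) * y powr p"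
    if "0 < x" "0 < y" for x y :: real
    using convex_onD[OF powr_convex[OF assms(4)], of "1 / (k + 1)" x y] that assms(3)
    by (simp add: field_simps)
  consider "a = 0" | "b = 0" | "a > 0" "b > 0" using assms by linarith
  then show ?thesis
  proof cases
    case 1
    have "1 \<le> (k + 1) powr (p - 1)" using assms by (simp add: ge_one_powr_ge_zero)
    then have "1 * b powr p \<le> (k + 1) powr (p - 1) * b powr p" by (intro mult_right_mono) auto
    then show ?thesis using 1 by simp
  next
    case 2
    have "k powr (p - 1) \<le> (k + 1) powr (p - 1)" using assms by (intro powr_mono2) auto
    then have "1 \<le> (k + 1) powr (p - 1) / k powr (p - 1)" using assms by (simp add: field_simps)
    then have "1 * a powr p \<le> (k + 1) powr (p - 1) / k powr (p - 1) * a powr p" by (intro mult_right_mono) auto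
    then show ?thesis using 2 by (simp add: field_simps)
  next
    case 3
    define m where "m = k + 1"
    have k: "k > 0" "m > 0" using assms by (auto simp: m_def)
    have "a + b = k / m * (a * m / k) + 1 / m * (b * m)"
      using k by (simp add: field_simps)
    then have "(a + b) powr p \<le> k / m * (a * m / k) powr p + 1 / m * (b * m) powr p"
      using conv[of "a * m / k" "b * m"] 3 k by (simp add: m_def[symmetric])
    also have "\<dots> = m powr (p - 1) * (a powr p / k powr (p - 1) + b powr p)"
      using 3 k by (simp add: powr_mult powr_divide powr_diff field_simps)
    finally have "(a + b) powr p \<le> m powr (p - 1) * (a powr p / k powr (p - 1) + b powr p)" .
    then show ?thesis by (simp add: m_def)
  qed
qed

section \<open>Word length and translation energy\<close>

locale marked_group = group G for G :: "('a, 'm) monoid_scheme" (structure) +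
  fixes S :: "'a list"
  assumes generating: "generating_tuple G S"
begin

definition prod_word :: "'a list \<Rightarrow> 'a" where
  "prod_word w = foldr (\<lambda>x y. x \<otimes> y) w \<one>"

lemma prod_word_simps [simp]: "prod_word [] = \<one>" "prod_word (a # w) = a \<otimes> prod_word w"
  by (simp_all add: prod_word_def)

lemma sym_gens_carrier: "sym_gens G S \<subseteq> carrier G"
  using generating by (auto simp: generating_tuple_def sym_gens_def)

lemma inv_sym_gens: "a \<in> sym_gens G S \<Longrightarrow> inv a \<in> sym_gens G S"
  using generating by (auto simp: generating_tuple_def sym_gens_def subset_iff)

lemma finite_sym_gens: "finite (sym_gens G S)" and sym_gens_nonempty: "sym_gens G S \<noteq> {}"
  by (auto simp: sym_gens_def)

lemma prod_word_closed: "set w \<subseteq> sym_gens G S \<Longrightarrow> prod_word w \<in> carrier G"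
  using sym_gens_carrier by (induction w) auto

lemma prod_word_append:
  "set v \<subseteq> sym_gens G S \<Longrightarrow> set w \<subseteq> sym_gens G S \<Longrightarrow> prod_word (v @ w) = prod_word v \<otimes> prod_word w"
  using sym_gens_carrier by (induction v) (auto simp: prod_word_closed m_assoc subset_iff)

lemma prod_word_rev:
  "set w \<subseteq> sym_gens G S \<Longrightarrow> prod_word (rev (map (\<lambda>a. inv a) w)) = inv (prod_word w)"
proof (induction w)
  case (Cons a w)
  then have "set (rev (map (\<lambda>a. inv a) w)) \<subseteq> sym_gens G S" "set [inv a] \<subseteq> sym_gens G S"
    using inv_sym_gens by auto
  then show ?case using Cons sym_gens_carrier
    by (simp add: prod_word_append prod_word_closed inv_mult_group subset_iff)
qed simp

lemma exists_word:
  assumes "g \<in> carrier G"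
  shows "\<exists>w. set w \<subseteq> sym_gens G S \<and> prod_word w = g"
proof -
  have sub: "set S \<subseteq> carrier G" using generating by (simp add: generating_tuple_def)
  have "g \<in> generate G (set S)" using assms generating by (simp add: generating_tuple_def)
  then show ?thesis
  proof (induction rule: generate.induct)
    case one
    then show ?case by (intro exI[of _ "[]"]) simp
  next
    case (incl h)
    then show ?case using sub by (intro exI[of _ "[h]"]) (auto simp: sym_gens_def)
  next
    case (inv h)
    then show ?case using sub by (intro exI[of _ "[inv h]"]) (auto simp: sym_gens_def)
  next
    case (eng h1 h2)
    then obtain v w where "set v \<subseteq> sym_gens G S" "prod_word v = h1" "set w \<subseteq> sym_gens G S" "prod_word w = h2"
      by auto
    then show ?case by (intro exI[of _ "v @ w"]) (simp add: prod_word_append)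
  qed
qed

abbreviation wl :: "'a \<Rightarrow> nat" where "wl \<equiv> word_length G S"

lemma wl_le: "set w \<subseteq> sym_gens G S \<Longrightarrow> wl (prod_word w) \<le> length w"
  unfolding word_length_def prod_word_def by (rule Least_le) auto

lemma shortest_word:
  assumes "g \<in> carrier G"
  obtains w where "set w \<subseteq> sym_gens G S" "prod_word w = g" "length w = wl g"
proof -
  have "\<exists>n w. length w = n \<and> set w \<subseteq> sym_gens G S \<and> foldr (\<lambda>x y. x \<otimes> y) w \<one> = g"
    using exists_word[OF assms] by (auto simp: prod_word_def)
  from LeastI_ex[OF this] show ?thesis
    using that by (auto simp: word_length_def prod_word_def)
qed

lemma wl_mult_le:
  assumes "g \<in> carrier G" "h \<in> carrier G"
  shows "wl (g \<otimes> h) \<le> wl g + wl h"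
proof -
  obtain v w where v: "set v \<subseteq> sym_gens G S" "prod_word v = g" "length v = wl g"
    and w: "set w \<subseteq> sym_gens G S" "prod_word w = h" "length w = wl h"
    using shortest_word[OF assms(1)] shortest_word[OF assms(2)] by metis
  show ?thesis using wl_le[of "v @ w"] v w by (simp add: prod_word_append)
qed

lemma wl_inv_le:
  assumes "g \<in> carrier G"
  shows "wl (inv g) \<le> wl g"
proof -
  obtain w where w: "set w \<subseteq> sym_gens G S" "prod_word w = g" "length w = wl g"
    using shortest_word[OF assms] by metis
  have "set (rev (map (\<lambda>a. inv a) w)) \<subseteq> sym_gens G S" using w(1) inv_sym_gens by auto
  from wl_le[OF this] show ?thesis using w by (simp add: prod_word_rev)
qed

lemma wl_one [simp]: "wl \<one> = 0"
  using wl_le[of "[]"] by simp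


text \<open>The \<open>p\<close>-th power of the \<open>\<ell>\<^sup>p\<close> distance between \<open>f\<close> and its right translate by \<open>g\<close>.\<close>

definition shift_diff :: "real \<Rightarrow> ('a \<Rightarrow> real) \<Rightarrow> 'a \<Rightarrow> ennreal" where
  "shift_diff p f g = (\<integral>\<^sup>+x. ennreal (\<bar>f (x \<otimes> g) - f x\<bar> powr p) \<partial>count_space (carrier G))"

lemma shift_diff_mult_le:
  assumes "1 \<le> p" "1 \<le> k" "a \<in> carrier G" "g \<in> carrier G"
  shows "shift_diff p f (a \<otimes> g) \<le> ennreal ((k + 1) powr (p - 1)) *
    (shift_diff p f g / ennreal (k powr (p - 1)) + shift_diff p f a)"
proof -
  let ?c = "ennreal ((k + 1) powr (p - 1))" and ?d = "ennreal (1 / k powr (p - 1))"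
  let ?u = "\<lambda>x. ennreal (\<bar>f (x \<otimes> a \<otimes> g) - f (x \<otimes> a)\<bar> powr p)"
    and ?v = "\<lambda>x. ennreal (\<bar>f (x \<otimes> a) - f x\<bar> powr p)"
  have "shift_diff p f (a \<otimes> g) \<le> (\<integral>\<^sup>+x. ?c * (?d * ?u x + ?v x) \<partial>count_space (carrier G))"
    unfolding shift_diff_def
  proof (intro nn_integral_mono)
    fix x assume "x \<in> space (count_space (carrier G))"
    then have x: "x \<otimes> (a \<otimes> g) = x \<otimes> a \<otimes> g" using assms by (simp add: m_assoc)
    have "\<bar>f (x \<otimes> (a \<otimes> g)) - f x\<bar> powr p
        \<le> (\<bar>f (x \<otimes> a \<otimes> g) - f (x \<otimes> a)\<bar> + \<bar>f (x \<otimes> a) - f x\<bar>) powr p"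
      unfolding x using assms by (intro powr_mono2) auto
    also have "\<dots> \<le> (k + 1) powr (p - 1) * (\<bar>f (x \<otimes> a \<otimes> g) - f (x \<otimes> a)\<bar> powr p / k powr (p - 1)
        + \<bar>f (x \<otimes> a) - f x\<bar> powr p)"
      using assms by (intro powr_add_le_weighted) auto
    finally have "ennreal (\<bar>f (x \<otimes> (a \<otimes> g)) - f x\<bar> powr p) \<le> ennreal \<dots>"
      by (rule ennreal_leI)
    then show "ennreal (\<bar>f (x \<otimes> (a \<otimes> g)) - f x\<bar> powr p) \<le> ?c * (?d * ?u x + ?v x)"
      by (simp add: ennreal_mult'[symmetric] ennreal_plus[symmetric] del: ennreal_plus)
  qed
  also have "\<dots> = ?c * (?d * (\<integral>\<^sup>+x. ?u x \<partial>count_space (carrier G)) + shift_diff p f a)"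
    by (simp add: nn_integral_cmult nn_integral_add shift_diff_def)
  also have "(\<integral>\<^sup>+x. ?u x \<partial>count_space (carrier G)) = shift_diff p f g"
    unfolding shift_diff_def
    by (rule nn_integral_bij_count_space[OF bij_betw_right_mult[OF assms(3)]])
  also have "?d * shift_diff p f g = shift_diff p f g / ennreal (k powr (p - 1))"
    using assms by (simp add: divide_ennreal_def inverse_ennreal mult.commute inverse_eq_divide)
  finally show ?thesis .
qed

lemma shift_diff_word_le:
  assumes p: "1 \<le> p" and K: "\<And>a. a \<in> sym_gens G S \<Longrightarrow> shift_diff p f a \<le> ennreal K" "0 \<le> K"
  shows "set w \<subseteq> sym_gens G S \<Longrightarrow> shift_diff p f (prod_word w) \<le> ennreal (real (length w) powr p * K)"
proof (induction w)
  case Nil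
  have "shift_diff p f \<one> = (\<integral>\<^sup>+x. 0 \<partial>count_space (carrier G))"
    unfolding shift_diff_def by (intro nn_integral_cong) (use p in auto)
  then show ?case by simp
next
  case (Cons a w)
  then have a: "a \<in> carrier G" "shift_diff p f a \<le> ennreal K" and w: "set w \<subseteq> sym_gens G S"
    using K sym_gens_carrier by auto
  show ?case
  proof (cases "w = []")
    case True
    then show ?thesis using a by simp
  next
    case False
    define k where "k = real (length w)"
    have k: "1 \<le> k" using False by (cases w) (auto simp: k_def)
    have IH: "shift_diff p f (prod_word w) \<le> ennreal (k powr p * K)" using Cons w by (simp add: k_def)
    have "shift_diff p f (a \<otimes> prod_word w) \<le> ennreal ((k + 1) powr (p - 1)) *
      (shift_diff p f (prod_word w) / ennreal (k powr (p - 1)) + shift_diff p f a)"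
      by (rule shift_diff_mult_le[OF p k a(1) prod_word_closed[OF w]])
    also have "\<dots> \<le> ennreal ((k + 1) powr (p - 1)) *
      (ennreal (k powr p * K) / ennreal (k powr (p - 1)) + ennreal K)"
      by (intro mult_left_mono add_mono a divide_right_mono_ennreal IH) auto
    also have "\<dots> = ennreal ((k + 1) powr (p - 1) * (k powr p * K / k powr (p - 1) + K))"
      using k K(2) by (simp add: divide_ennreal ennreal_mult'[symmetric] ennreal_plus[symmetric] del: ennreal_plus)
    also have "k powr p * K / k powr (p - 1) + K = (k + 1) * K"
      using k by (simp add: powr_diff algebra_simps)
    also have "(k + 1) powr (p - 1) * ((k + 1) * K) = (k + 1) powr p * K"
      using k by (simp add: powr_diff)
    finally show ?thesis by (simp add: k_def add.commute)
  qed
qed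


text \<open>
  The pseudo-Poincare inequality: along a shortest word for \<open>g\<close> the function changes by
  \<open>wl g\<close> increments, each of which costs a generator translation, and the counting measure is
  invariant under the translations by prefixes.
\<close>

lemma shift_diff_le:
  assumes "1 \<le> p" "\<And>a. a \<in> sym_gens G S \<Longrightarrow> shift_diff p f a \<le> ennreal K" "0 \<le> K" "g \<in> carrier G"
  shows "shift_diff p f g \<le> ennreal (real (wl g) powr p * K)"
  using shortest_word[OF assms(4)] shift_diff_word_le[OF assms(1-3)] by metis


text \<open>
  A single generator carries mass \<open>1 / N\<close> in the uniform measure on the \<open>N\<close> symmetric generators,
  and the factor 2 undoes the one half in the energy.
\<close>

lemma shift_diff_le_energy:
  assumes a: "a \<in> sym_gens G S"
  shows "shift_diff p f a \<le> ennreal (2 * real (card (sym_gens G S))) * energy G p (unif_gens G S) f"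
proof -
  have two_half: "ennreal 2 * (ennreal (1 / 2) * X) = X" for X
  proof -
    have "ennreal 2 * ennreal (1 / 2) = ennreal (2 * (1 / 2))" by (rule ennreal_mult'[symmetric]) simp
    then have "ennreal 2 * ennreal (1 / 2) = 1" by simp
    then show ?thesis by (simp only: mult.assoc[symmetric] mult_1)
  qed
  define N where "N = real (card (sym_gens G S))"
  have N: "N > 0" using finite_sym_gens sym_gens_nonempty by (auto simp: N_def card_gt_0_iff)
  have ac: "a \<in> carrier G" using a sym_gens_carrier by auto
  let ?F = "\<lambda>(x, y). ennreal (\<bar>f (x \<otimes> y) - f x\<bar> powr p * pmf (unif_gens G S) y)"
  have pa: "pmf (unif_gens G S) a = 1 / N"
    using a finite_sym_gens sym_gens_nonempty by (simp add: unif_gens_def N_def)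
  have bij: "bij_betw (\<lambda>x. (x, a)) (carrier G) (carrier G \<times> {a})"
    by (auto simp: bij_betw_def inj_on_def)
  have "shift_diff p f a * ennreal (1 / N) = (\<integral>\<^sup>+x. ?F (x, a) \<partial>count_space (carrier G))"
    using N by (simp add: shift_diff_def pa ennreal_mult nn_integral_multc)
  also have "\<dots> = (\<integral>\<^sup>+z. ?F z \<partial>count_space (carrier G \<times> {a}))"
    by (rule nn_integral_bij_count_space[OF bij])
  also have "\<dots> = (\<integral>\<^sup>+z. ?F z * indicator (carrier G \<times> {a}) z \<partial>count_space (carrier G \<times> carrier G))"
    using ac by (subst (1 2) nn_integral_count_space_indicator)
      (auto intro!: nn_integral_cong simp: indicator_def)
  also have "\<dots> \<le> (\<integral>\<^sup>+z. ?F z \<partial>count_space (carrier G \<times> carrier G))"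
    by (intro nn_integral_mono) (auto simp: indicator_def)
  also have "\<dots> = ennreal 2 * energy G p (unif_gens G S) f"
    unfolding energy_def nn_integral_count_space_eq_infsum two_half by (simp add: case_prod_beta')
  finally have "ennreal N * (shift_diff p f a * ennreal (1 / N)) \<le> ennreal N * (ennreal 2 * energy G p (unif_gens G S) f)"
    by (intro mult_left_mono) auto
  moreover have "ennreal N * (shift_diff p f a * ennreal (1 / N)) = shift_diff p f a"
  proof -
    have "ennreal N * ennreal (1 / N) = ennreal (N * (1 / N))" using N by (intro ennreal_mult'[symmetric]) simp
    then have "ennreal N * ennreal (1 / N) = 1" using N by simp
    then show ?thesis by (simp only: mult.left_commute[of "ennreal N" "shift_diff p f a"] mult.right_neutral)
  qed
  moreover have "ennreal N * (ennreal 2 * X) = ennreal (2 * N) * X" for X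
    using N by (simp add: ennreal_mult mult.assoc[symmetric] mult.commute[of "ennreal N"])
  ultimately show ?thesis by (simp only: N_def)
qed

end

section \<open>Sets that the walk rarely leaves\<close>

context group begin

text \<open>
  Summing the correlations of \<open>q\<close> with its translates over the whole group gives the square of the
  total mass of \<open>q\<close>; this limits how many translates can be strongly correlated with \<open>q\<close>.
\<close>

lemma sum_corr_shift_le_1:
  assumes q: "set_pmf q \<subseteq> carrier G" and B: "finite B" "B \<subseteq> carrier G"
  shows "(\<Sum>g\<in>B. corr q (right_shift G q g)) \<le> 1"
proof -
  have "ennreal (\<Sum>g\<in>B. corr q (right_shift G q g)) = (\<Sum>g\<in>B. ennreal (corr q (right_shift G q g)))"
    by simp
  also have "\<dots> = (\<integral>\<^sup>+x. (\<Sum>g\<in>B. ennreal (pmf q x * pmf (right_shift G q g) x)) \<partial>count_space (carrier G))"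
    unfolding corr_carrier[OF q] by (rule nn_integral_sum[symmetric]) simp
  also have "\<dots> \<le> (\<integral>\<^sup>+x. ennreal (pmf q x) \<partial>count_space (carrier G))"
  proof (intro nn_integral_mono)
    fix x assume "x \<in> space (count_space (carrier G))"
    then have x: "x \<in> carrier G" by simp
    have inj: "inj_on (\<lambda>g. x \<otimes> inv g) B"
      using x B by (intro inj_onI) (metis inv_closed inv_inv inv_solve_left l_inv m_assoc r_one subsetD Units_eq Units_l_cancel)
    have "(\<Sum>g\<in>B. pmf (right_shift G q g) x) = (\<Sum>g\<in>B. pmf q (x \<otimes> inv g))"
      using x B q by (intro sum.cong) (auto simp: pmf_shift)
    also have "\<dots> = measure (measure_pmf q) ((\<lambda>g. x \<otimes> inv g) ` B)"
      using B by (simp add: measure_measure_pmf_finite sum.reindex[OF inj])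
    also have "\<dots> \<le> 1" by simp
    finally have "pmf q x * (\<Sum>g\<in>B. pmf (right_shift G q g) x) \<le> pmf q x"
      by (simp add: mult_left_le)
    then show "(\<Sum>g\<in>B. ennreal (pmf q x * pmf (right_shift G q g) x)) \<le> ennreal (pmf q x)"
      by (simp add: sum_distrib_left)
  qed
  also have "\<dots> \<le> 1"
    by (simp add: nn_integral_pmf measure_pmf.emeasure_le_1)
  finally show ?thesis by simp
qed

lemma corr_shift_le:
  assumes "set_pmf q \<subseteq> carrier G" "y \<in> carrier G"
  shows "corr q (right_shift G q y) \<le> corr q q"
  using corr_diff_nonneg[of q "right_shift G q y"] corr_shift_shift[OF assms(1,1,2)] by simp

lemma corr_shift_deficit:
  assumes q: "set_pmf q \<subseteq> carrier G" and g: "g \<in> carrier G"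
  shows "ennreal (2 * (corr q q - corr q (right_shift G q g))) =
    (\<integral>\<^sup>+x. ennreal ((pmf q (x \<otimes> g) - pmf q x)\<^sup>2) \<partial>count_space (carrier G))"
proof -
  let ?r = "right_shift G q g"
  have rs: "set_pmf ?r \<subseteq> carrier G" by (rule set_shift[OF q g])
  have int: "integrable (count_space UNIV) (\<lambda>x. (pmf ?r x - pmf q x)\<^sup>2)"
  proof -
    have "(\<lambda>x. (pmf ?r x - pmf q x)\<^sup>2) =
      (\<lambda>x. pmf ?r x * pmf ?r x - 2 * (pmf q x * pmf ?r x) + pmf q x * pmf q x)"
      by (auto simp: fun_eq_iff power2_eq_square algebra_simps)
    then show ?thesis by (simp only:) (simp add: integrable_pmf_mult)
  qed
  have "(\<integral>\<^sup>+x. ennreal ((pmf q (x \<otimes> g) - pmf q x)\<^sup>2) \<partial>count_space (carrier G)) =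
      (\<integral>\<^sup>+x. ennreal ((pmf ?r (x \<otimes> g) - pmf q (x \<otimes> g))\<^sup>2) \<partial>count_space (carrier G))"
    using q g by (intro nn_integral_cong) (auto simp: pmf_shift m_assoc power2_commute)
  also have "\<dots> = (\<integral>\<^sup>+x. ennreal ((pmf ?r x - pmf q x)\<^sup>2) \<partial>count_space (carrier G))"
    by (rule nn_integral_bij_count_space[OF bij_betw_right_mult[OF g]])
  also have "\<dots> = (\<integral>\<^sup>+x. ennreal ((pmf ?r x - pmf q x)\<^sup>2) \<partial>count_space UNIV)"
    using q rs by (intro nn_integral_count_space_eq) (auto simp: pmf_outside)
  also have "\<dots> = ennreal (\<integral>x. (pmf ?r x - pmf q x)\<^sup>2 \<partial>count_space UNIV)"
    by (rule nn_integral_eq_integral[OF int]) auto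
  also have "(\<integral>x. (pmf ?r x - pmf q x)\<^sup>2 \<partial>count_space UNIV) =
     (\<integral>x. pmf ?r x * pmf ?r x - 2 * (pmf q x * pmf ?r x) + pmf q x * pmf q x \<partial>count_space UNIV)"
    by (intro Bochner_Integration.integral_cong) (auto simp: power2_eq_square algebra_simps)
  also have "\<dots> = corr ?r ?r - 2 * corr q ?r + corr q q"
    by (simp add: corr_def integrable_pmf_mult)
  also have "\<dots> = 2 * (corr q q - corr q ?r)"
    by (simp add: corr_shift_shift[OF q q g])
  finally show ?thesis by simp
qed

lemma corr_walk_deficit_integral:
  "corr q q - corr q (convolution G q \<nu>) = (\<integral>g. corr q q - corr q (right_shift G q g) \<partial>measure_pmf \<nu>)"
  by (simp add: corr_convolution integrable_corr)

lemma superlevel_card_le: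
  assumes q: "set_pmf q \<subseteq> carrier G" and pos: "corr q q > 0"
  defines "A \<equiv> {g \<in> carrier G. corr q q / 2 \<le> corr q (right_shift G q g)}"
  shows "finite A" "real (card A) \<le> 2 / corr q q"
proof -
  have *: "real (card B) \<le> 2 / corr q q" if "finite B" "B \<subseteq> A" for B
  proof -
    have "real (card B) * (corr q q / 2) \<le> (\<Sum>g\<in>B. corr q (right_shift G q g))"
      using that by (intro sum_bounded_below[where A=B, simplified]) (auto simp: A_def)
    also have "\<dots> \<le> 1" using that by (intro sum_corr_shift_le_1[OF q]) (auto simp: A_def)
    finally show ?thesis using pos by (simp add: field_simps)
  qed
  show fin: "finite A"
  proof (rule finite_if_finite_subsets_card_bdd[of _ "nat \<lfloor>2 / corr q q\<rfloor>", THEN conjunct1])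
    fix B assume "B \<subseteq> A" "finite B"
    from *[OF this(2,1)] show "card B \<le> nat \<lfloor>2 / corr q q\<rfloor>" by linarith
  qed
  show "real (card A) \<le> 2 / corr q q" by (rule *[OF fin]) simp
qed

text \<open>
  Outside \<open>A\<close> the deficit \<open>corr q q - corr q (right_shift G q g)\<close> is at least half of
  \<open>corr q q\<close>, while its mean under the \<open>n\<close>-th convolution power is at most \<open>n\<close> times its mean under
  \<open>\<mu>\<close>. The claim is Markov's inequality.
\<close>

lemma walk_leaves_superlevel_le:
  assumes sym: "symmetric_measure G \<mu>" and q: "set_pmf q \<subseteq> carrier G" and pos: "corr q q > 0"
    and D: "corr q q - corr q (convolution G q \<mu>) \<le> D * corr q q"
  defines "A \<equiv> {g \<in> carrier G. corr q q / 2 \<le> corr q (right_shift G q g)}"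
  shows "measure (measure_pmf (conv_power G \<mu> n)) (- A) \<le> 2 * real n * D"
proof -
  let ?\<kappa> = "corr q q" and ?\<nu> = "measure_pmf (conv_power G \<mu> n)"
  have mu: "set_pmf \<mu> \<subseteq> carrier G" using sym by (simp add: symmetric_measure_def)
  have "?\<kappa> / 2 * measure ?\<nu> (- A) = (\<integral>g. ?\<kappa> / 2 * indicator (- A) g \<partial>?\<nu>)"
    by simp
  also have "\<dots> \<le> (\<integral>g. ?\<kappa> - corr q (right_shift G q g) \<partial>?\<nu>)"
  proof (rule integral_mono_AE)
    show "integrable ?\<nu> (\<lambda>g. ?\<kappa> / 2 * indicator (- A) g)"
      by (intro integrable_mult_right measure_pmf.integrable_const_bound[of _ 1]) (auto simp: indicator_def)
    show "AE g in ?\<nu>. ?\<kappa> / 2 * indicator (- A) g \<le> ?\<kappa> - corr q (right_shift G q g)"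
      unfolding AE_measure_pmf_iff
    proof
      fix g assume "g \<in> set_pmf (conv_power G \<mu> n)"
      then have "g \<in> carrier G" using set_conv_power[OF mu] by auto
      then show "?\<kappa> / 2 * indicator (- A) g \<le> ?\<kappa> - corr q (right_shift G q g)"
        using corr_shift_le[OF q] by (auto simp: indicator_def A_def)
    qed
  qed (simp add: integrable_corr)
  also have "\<dots> = ?\<kappa> - corr q (walk q \<mu> n)"
    by (simp add: walk_eq_convolution[OF q mu] corr_walk_deficit_integral)
  also have "\<dots> \<le> real n * (D * ?\<kappa>)"
    using corr_walk_ge[OF sym q, of n] mult_left_mono[OF D, of "real n"] by simp
  finally show ?thesis using pos by (simp add: field_simps)
qed

end

context marked_group begin

text \<open>
  A function of small \<open>p\<close>-energy provides a small set that the walk is unlikely to leave, the same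
  set for all times. The mass function \<open>q\<close> is proportional to \<open>\<bar>f\<bar> powr (p / 2)\<close>; translating by
  \<open>g\<close> costs at most a multiple of \<open>wl g powr p\<close>, which has finite mean under \<open>\<mu>\<close>. By the
  Cauchy-Schwarz inequality \<open>corr q q\<close> is at least the inverse of the size of the support of \<open>f\<close>,
  which bounds the size of the superlevel set.
\<close>

lemma good_set_of_function:
  assumes p: "1 \<le> p" "p \<le> 2"
    and f: "finite (support_on G f)" "lp_norm G p f = 1"
    and v: "real (card (support_on G f)) \<le> v"
    and K: "\<And>a. a \<in> sym_gens G S \<Longrightarrow> shift_diff p f a \<le> ennreal K" "0 \<le> K"
    and sym: "symmetric_measure G \<mu>"
    and mom: "integrable (measure_pmf \<mu>) (\<lambda>g. real (wl g) powr p)"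
  shows "\<exists>A. finite A \<and> A \<subseteq> carrier G \<and> real (card A) \<le> 2 * v \<and>
    (\<forall>n. measure (measure_pmf (conv_power G \<mu> n)) (- A)
        \<le> real n * K * (\<integral>g. real (wl g) powr p \<partial>measure_pmf \<mu>))"
proof -
  have mu: "set_pmf \<mu> \<subseteq> carrier G" using sym by (simp add: symmetric_measure_def)
  define F where "F = support_on G f"
  define h where "h x = (if x \<in> F then \<bar>f x\<bar> powr (p / 2) else 0)" for x
  have finF: "finite F" and Fc: "F \<subseteq> carrier G" using f by (auto simp: F_def support_on_def)
  have h_carrier: "h x = \<bar>f x\<bar> powr (p / 2)" if "x \<in> carrier G" for x
    using that p by (auto simp: h_def F_def support_on_def)
  have h0: "0 \<le> h x" for x by (simp add: h_def)
  have "(\<Sum>\<^sub>\<infinity>x\<in>carrier G. \<bar>f x\<bar> powr p) = (\<Sum>x\<in>F. \<bar>f x\<bar> powr p)"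
    using finF Fc p by (subst infsum_finite[symmetric], simp)
       (intro infsum_cong_neutral, auto simp: F_def support_on_def)
  moreover have "(\<Sum>\<^sub>\<infinity>x\<in>carrier G. \<bar>f x\<bar> powr p) = 1"
  proof -
    have nn: "0 \<le> (\<Sum>\<^sub>\<infinity>x\<in>carrier G. \<bar>f x\<bar> powr p)" by (intro infsum_nonneg) auto
    have "((\<Sum>\<^sub>\<infinity>x\<in>carrier G. \<bar>f x\<bar> powr p) powr (1 / p)) powr p = 1"
      using f(2) by (simp add: lp_norm_def)
    then show ?thesis using nn p by (simp add: powr_powr)
  qed
  moreover have hsq: "(h x)\<^sup>2 = \<bar>f x\<bar> powr p" if "x \<in> F" for x
    using that by (simp add: h_def power2_eq_square powr_add[symmetric])
  ultimately have h2: "(\<Sum>x\<in>F. (h x)\<^sup>2) = 1" by simp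
  define c where "c = (\<Sum>x\<in>F. h x)"
  have c: "c > 0"
  proof (rule ccontr)
    assume "\<not> c > 0"
    then have "c = 0" using h0 sum_nonneg[of F h] by (simp add: c_def)
    then have "\<forall>x\<in>F. h x = 0" using finF h0 by (simp add: c_def sum_nonneg_eq_0_iff)
    then show False using h2 by simp
  qed
  have c2: "c\<^sup>2 \<le> real (card F)"
    using Cauchy_Schwarz_ineq_sum[of "\<lambda>_. 1" h F] h2 by (simp add: c_def)
  define q where "q = embed_pmf (\<lambda>x. h x / c)"
  have "(\<integral>\<^sup>+x. ennreal (h x / c) \<partial>count_space UNIV) = (\<integral>\<^sup>+x. ennreal (h x / c) \<partial>count_space F)"
    by (intro nn_integral_count_space_eq) (auto simp: h_def)
  also have "\<dots> = ennreal (\<Sum>x\<in>F. h x / c)"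
    using finF h0 c by (simp add: nn_integral_count_space_finite)
  also have "\<dots> = 1" using c by (simp add: c_def sum_divide_distrib[symmetric])
  finally have pq: "pmf q x = h x / c" for x
    unfolding q_def using h0 c by (intro pmf_embed_pmf) auto
  have qF: "set_pmf q \<subseteq> F" by (auto simp: set_pmf_iff pq h_def split: if_splits)
  then have qc: "set_pmf q \<subseteq> carrier G" using Fc by blast
  have kap: "corr q q = 1 / c\<^sup>2"
  proof -
    have "ennreal (corr q q) = (\<integral>\<^sup>+x. ennreal (pmf q x * pmf q x) \<partial>count_space F)"
      unfolding ennreal_corr by (intro nn_integral_count_space_eq) (auto simp: pq h_def)
    also have "\<dots> = ennreal (\<Sum>x\<in>F. pmf q x * pmf q x)"
      using finF by (simp add: nn_integral_count_space_finite)
    also have "(\<Sum>x\<in>F. pmf q x * pmf q x) = (\<Sum>x\<in>F. (h x)\<^sup>2) / c\<^sup>2"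
      by (simp add: pq power2_eq_square sum_divide_distrib)
    finally show ?thesis using h2 by simp
  qed
  define M where "M = (\<integral>g. real (wl g) powr p \<partial>measure_pmf \<mu>)"
  have deficit: "corr q q - corr q (right_shift G q g) \<le> real (wl g) powr p * K / 2 * corr q q"
    if g: "g \<in> carrier G" for g
  proof -
    have "ennreal (2 * (corr q q - corr q (right_shift G q g))) \<le>
        (\<integral>\<^sup>+x. ennreal (1 / c\<^sup>2) * ennreal (\<bar>f (x \<otimes> g) - f x\<bar> powr p) \<partial>count_space (carrier G))"
      unfolding corr_shift_deficit[OF qc g]
    proof (intro nn_integral_mono)
      fix x assume "x \<in> space (count_space (carrier G))"
      then have x: "x \<in> carrier G" "x \<otimes> g \<in> carrier G" using g by auto
      have "(pmf q (x \<otimes> g) - pmf q x)\<^sup>2 = 1 / c\<^sup>2 * (\<bar>f (x \<otimes> g)\<bar> powr (p / 2) - \<bar>f x\<bar> powr (p / 2))\<^sup>2"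
        using x by (simp add: pq h_carrier diff_divide_distrib[symmetric] power_divide)
      also have "\<dots> \<le> 1 / c\<^sup>2 * \<bar>f (x \<otimes> g) - f x\<bar> powr p"
        using p by (intro mult_left_mono powr_half_diff_square_le) auto
      finally show "ennreal ((pmf q (x \<otimes> g) - pmf q x)\<^sup>2) \<le> ennreal (1 / c\<^sup>2) * ennreal (\<bar>f (x \<otimes> g) - f x\<bar> powr p)"
        by (simp add: ennreal_mult'[symmetric] ennreal_leI)
    qed
    also have "\<dots> = ennreal (1 / c\<^sup>2) * shift_diff p f g"
      by (simp add: shift_diff_def nn_integral_cmult)
    also have "\<dots> \<le> ennreal (1 / c\<^sup>2) * ennreal (real (wl g) powr p * K)"
      by (intro mult_left_mono shift_diff_le[OF p(1) K g]) auto
    also have "\<dots> = ennreal (1 / c\<^sup>2 * (real (wl g) powr p * K))"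
      by (rule ennreal_mult'[symmetric]) simp
    finally have "2 * (corr q q - corr q (right_shift G q g)) \<le> 1 / c\<^sup>2 * (real (wl g) powr p * K)"
      using K(2) by (subst (asm) ennreal_le_iff) auto
    moreover have "real (wl g) powr p * K / 2 * corr q q = 1 / c\<^sup>2 * (real (wl g) powr p * K) / 2"
      by (simp add: kap)
    ultimately show ?thesis
      by (simp only: le_divide_eq_numeral1 mult.commute[of _ 2])
  qed
  have "corr q q - corr q (convolution G q \<mu>) \<le> (\<integral>g. real (wl g) powr p * (K / 2 * corr q q) \<partial>measure_pmf \<mu>)"
    unfolding corr_walk_deficit_integral
    using mu deficit by (intro integral_mono_AE) (auto simp: integrable_corr AE_measure_pmf_iff mom mult.assoc subset_iff)
  also have "\<dots> = K / 2 * M * corr q q"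
    using mom by (simp add: M_def)
  finally have D: "corr q q - corr q (convolution G q \<mu>) \<le> K / 2 * M * corr q q" .
  have pos: "corr q q > 0" using c by (simp add: kap)
  let ?A = "{g \<in> carrier G. corr q q / 2 \<le> corr q (right_shift G q g)}"
  show ?thesis
  proof (intro exI[of _ ?A] conjI allI)
    show "finite ?A" by (rule superlevel_card_le[OF qc pos])
    have "real (card ?A) \<le> 2 / corr q q" by (rule superlevel_card_le[OF qc pos])
    also have "\<dots> \<le> 2 * v" using c2 v by (simp add: kap F_def)
    finally show "real (card ?A) \<le> 2 * v" .
    show "measure (measure_pmf (conv_power G \<mu> n)) (- ?A) \<le> real n * K * (\<integral>g. real (wl g) powr p \<partial>measure_pmf \<mu>)" for n
      using walk_leaves_superlevel_le[OF sym qc pos D, of n] by (simp add: M_def mult.assoc)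
  qed auto
qed

end

section \<open>Entropy of measures concentrated at exponential scales\<close>

text \<open>
  Coding interpretation: an outcome of probability \<open>t\<close> may be given any code length \<open>L\<close>, at the
  price of the Kraft term \<open>exp (- L)\<close>.
\<close>

lemma neg_ln_mult_le:
  fixes t L :: real
  assumes "0 \<le> t"
  shows "- ln t * t \<le> t * L + exp (- L)"
proof (cases "t = 0")
  case False
  then have t: "t > 0" using assms by simp
  have "ln (exp (- L) / t) \<le> exp (- L) / t - 1"
    using t by (intro ln_le_minus_one) auto
  then have "- L - ln t \<le> exp (- L) / t - 1" using t by (simp add: ln_div)
  then have "t * (- L - ln t) \<le> t * (exp (- L) / t - 1)" using t by (intro mult_left_mono) auto
  then have "- ln t * t \<le> t * L + exp (- L) - t" using t by (simp add: algebra_simps)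
  then show ?thesis using t by simp
qed auto

text \<open>
  Encode \<open>g\<close> with length \<open>2 * 2 ^ j * R\<close>, where \<open>A j\<close> is the first of the sets containing \<open>g\<close>. The
  doubling makes the Kraft sum finite in spite of the size of the sets, and the expected length
  is a geometric series, since \<open>A j\<close> fails to contain the sample with probability of order
  \<open>2 powr (- b * j)\<close> with \<open>b > 1\<close>.
\<close>

lemma entropy_finite_sum_le:
  fixes \<nu> :: "'a pmf" and A :: "nat \<Rightarrow> 'a set"
  assumes R: "1 \<le> R" and b: "1 < b" and C: "0 \<le> C"
    and fin: "\<And>j. finite (A j)" and card: "\<And>j. real (card (A j)) \<le> 2 * exp (2 ^ j * R)"
    and mass: "\<And>j. measure (measure_pmf \<nu>) (- A j) \<le> C * 2 powr (- b * real j)"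
    and F: "finite F"
  shows "(\<Sum>g\<in>F. - ln (pmf \<nu> g) * pmf \<nu> g) \<le> (6 + 2 * C / (1 - 2 powr (1 - b))) * R"
proof -
  define r where "r = (2::real) powr (1 - b)"
  have r: "0 < r" "r < 1" using b by (auto simp: r_def powr_less_one)
  define F' where "F' = {g \<in> F. 0 < pmf \<nu> g}"
  have finF': "finite F'" using F by (simp add: F'_def)
  have tend: "(\<lambda>j. C * 2 powr (- b * real j)) \<longlonglongrightarrow> C * 0"
    using b by (intro tendsto_intros) real_asymp
  have ex: "\<exists>j. g \<in> A j" if "g \<in> F'" for g
  proof (rule ccontr)
    assume "\<nexists>j. g \<in> A j"
    then have "pmf \<nu> g \<le> C * 2 powr (- b * real j)" for j
      using mass[of j] measure_pmf.finite_measure_mono[of "{g}" "- A j" \<nu>]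
      by (force simp: pmf.rep_eq)
    then have "pmf \<nu> g \<le> C * 0" by (intro LIMSEQ_le_const[OF tend]) auto
    then show False using that by (simp add: F'_def)
  qed
  define J where "J g = (LEAST j. g \<in> A j)" for g
  have J_in: "g \<in> A (J g)" if "g \<in> F'" for g using LeastI_ex[OF ex[OF that]] by (simp add: J_def)
  have J_less: "g \<notin> A j" if "j < J g" for g j using not_less_Least that by (auto simp: J_def)
  define L where "L g = 2 * (2 ^ J g * R)" for g
  define N where "N = Suc (Max (insert 0 (J ` F')))"
  have JN: "J g < N" if "g \<in> F'" for g using that finF' by (auto simp: N_def less_Suc_eq_le intro!: Max_ge)
  have "(\<Sum>g\<in>F. - ln (pmf \<nu> g) * pmf \<nu> g) = (\<Sum>g\<in>F'. - ln (pmf \<nu> g) * pmf \<nu> g)"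
    using F by (intro sum.mono_neutral_right) (auto simp: F'_def)
  also have "\<dots> \<le> (\<Sum>g\<in>F'. pmf \<nu> g * L g + exp (- L g))"
    by (intro sum_mono neg_ln_mult_le) simp
  also have "\<dots> = (\<Sum>g\<in>F'. pmf \<nu> g * L g) + (\<Sum>g\<in>F'. exp (- L g))"
    by (simp add: sum.distrib)
  also have "(\<Sum>g\<in>F'. exp (- L g)) \<le> 4"
  proof -
    have "(\<Sum>g\<in>F'. exp (- L g)) = (\<Sum>j<N. \<Sum>g\<in>{g\<in>F'. J g = j}. exp (- L g))"
      using finF' JN by (intro sum.group[symmetric]) auto
    also have "\<dots> \<le> (\<Sum>j<N. 2 * (1 / 2) ^ j)"
    proof (intro sum_mono)
      fix j
      have "(\<Sum>g\<in>{g\<in>F'. J g = j}. exp (- L g)) = real (card {g\<in>F'. J g = j}) * exp (- (2 * (2 ^ j * R)))"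
        by (simp add: L_def)
      also have "\<dots> \<le> real (card (A j)) * exp (- (2 * (2 ^ j * R)))"
        using J_in fin by (intro mult_right_mono of_nat_mono card_mono) auto
      also have "\<dots> \<le> 2 * exp (2 ^ j * R) * exp (- (2 * (2 ^ j * R)))"
        using card by (intro mult_right_mono) auto
      also have "\<dots> = 2 * exp (- (2 ^ j * R))" by (simp add: exp_add[symmetric])
      also have "\<dots> \<le> 2 * (1 / 2 ^ j)"
      proof -
        have "2 ^ j * 1 \<le> 2 ^ j * R" using R by (intro mult_left_mono) auto
        also have "\<dots> \<le> exp (2 ^ j * R)" using exp_ge_add_one_self[of "2 ^ j * R"] by linarith
        finally have "1 / exp (2 ^ j * R) \<le> 1 / 2 ^ j" by (intro divide_left_mono) auto
        then show ?thesis by (simp add: exp_minus inverse_eq_divide)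
      qed
      finally show "(\<Sum>g\<in>{g\<in>F'. J g = j}. exp (- L g)) \<le> 2 * (1 / 2) ^ j" by (simp add: power_divide)
    qed
    also have "\<dots> \<le> 4" by (simp add: sum_distrib_left[symmetric] sum_gp_strict)
    finally show ?thesis .
  qed
  also have "(\<Sum>g\<in>F'. pmf \<nu> g * L g) \<le> 2 * R * (1 + C / (1 - r))"
  proof -
    define I where "I j g = (indicator (- A j) g :: real)" for j g
    \<comment> \<open>All the sets before the first one containing \<open>g\<close> are missed, and \<open>2 ^ J = 1 + (\<Sum>j<J. 2 ^ j)\<close>.\<close>
    have pow: "2 ^ J g \<le> 1 + (\<Sum>j<N. 2 ^ j * I j g)" if "g \<in> F'" for g
    proof -
      have "(2::real) ^ J g = 1 + (\<Sum>j<J g. 2 ^ j)" by (simp add: sum_gp_strict)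
      also have "(\<Sum>j<J g. 2 ^ j) = (\<Sum>j<J g. 2 ^ j * I j g)"
        using J_less by (intro sum.cong) (auto simp: I_def)
      also have "\<dots> \<le> (\<Sum>j<N. 2 ^ j * I j g)"
        using JN[OF that] by (intro sum_mono2) (auto simp: I_def)
      finally show ?thesis by simp
    qed
    have "(\<Sum>g\<in>F'. pmf \<nu> g * L g) \<le> (\<Sum>g\<in>F'. pmf \<nu> g * (2 * R * (1 + (\<Sum>j<N. 2 ^ j * I j g))))"
      unfolding L_def using pow R by (intro sum_mono mult_left_mono) (auto simp: mult.assoc mult.commute[of R])
    also have "\<dots> = 2 * R * ((\<Sum>g\<in>F'. pmf \<nu> g) + (\<Sum>j<N. 2 ^ j * (\<Sum>g\<in>F'. pmf \<nu> g * I j g)))"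
      by (simp add: sum_distrib_left sum.distrib algebra_simps, rule sum.swap)
    also have "\<dots> \<le> 2 * R * (1 + (\<Sum>j<N. 2 ^ j * (C * 2 powr (- b * real j))))"
    proof (intro mult_left_mono add_mono sum_mono)
      show "(\<Sum>g\<in>F'. pmf \<nu> g) \<le> 1"
        using finF' by (simp add: measure_measure_pmf_finite[symmetric])
      fix j
      have "(\<Sum>g\<in>F'. pmf \<nu> g * I j g) = (\<Sum>g\<in>F' - A j. pmf \<nu> g)"
        using finF' by (intro sum.mono_neutral_cong_right) (auto simp: I_def indicator_def)
      also have "\<dots> = measure (measure_pmf \<nu>) (F' - A j)"
        using finF' by (simp add: measure_measure_pmf_finite)
      also have "\<dots> \<le> measure (measure_pmf \<nu>) (- A j)"
        by (intro measure_pmf.finite_measure_mono) auto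
      finally show "(\<Sum>g\<in>F'. pmf \<nu> g * I j g) \<le> C * 2 powr (- b * real j)"
        using mass[of j] by simp
    qed (use R in auto)
    also have "(\<Sum>j<N. 2 ^ j * (C * 2 powr (- b * real j))) = C * (\<Sum>j<N. r ^ j)"
      unfolding sum_distrib_left
    proof (intro sum.cong refl)
      fix j
      have "2 ^ j * 2 powr (- b * real j) = (2::real) powr (real j + - b * real j)"
        by (simp only: powr_add powr_realpow[of 2 j, simplified])
      also have "\<dots> = (2 powr (1 - b)) powr real j"
        by (simp add: powr_powr algebra_simps)
      also have "\<dots> = r ^ j" by (simp add: r_def powr_realpow)
      finally show "2 ^ j * (C * 2 powr (- b * real j)) = C * r ^ j" by (simp add: mult_ac)
    qed
    also have "2 * R * (1 + C * (\<Sum>j<N. r ^ j)) \<le> 2 * R * (1 + C * (1 / (1 - r)))"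
      using r R C by (intro mult_left_mono add_left_mono) (auto simp: sum_gp_strict divide_right_mono)
    finally show ?thesis by simp
  qed
  finally have "(\<Sum>g\<in>F. - ln (pmf \<nu> g) * pmf \<nu> g) \<le> 2 * R * (1 + C / (1 - r)) + 4" by simp
  also have "\<dots> \<le> 2 * R * (1 + C / (1 - r)) + 4 * R" using R by simp
  finally show ?thesis by (simp add: r_def algebra_simps)
qed

section \<open>Entropy increments control fluctuations\<close>

lemma neg_ln_mult_bounds:
  fixes x :: real
  assumes "0 \<le> x" "x \<le> 1"
  shows "0 \<le> - ln x * x" "\<bar>- ln x * x\<bar> \<le> 1"
proof -
  show nn: "0 \<le> - ln x * x" using assms by (cases "x = 0") (auto simp: mult_nonpos_nonneg)
  show "\<bar>- ln x * x\<bar> \<le> 1"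
  proof (cases "x = 0")
    case False
    then have x: "x > 0" using assms by simp
    have "ln (1 / x) \<le> 1 / x - 1" using x by (intro ln_le_minus_one) auto
    then have "x * ln (1 / x) \<le> x * (1 / x - 1)" using x by (intro mult_left_mono) auto
    then have "- ln x * x \<le> 1" using x by (simp add: ln_div algebra_simps)
    then show ?thesis using nn by simp
  qed simp
qed

text \<open>
  The inequality \<open>ln r \<le> r - 1\<close> at \<open>r = sqrt (b / a)\<close>, which improves Jensen's inequality for the
  entropy function by a Hellinger term.
\<close>

lemma entropy_gap_pointwise:
  fixes a b :: real
  assumes "0 \<le> a" "0 \<le> b" "b = 0 \<Longrightarrow> a = 0"
  shows "- ln a * a + (sqrt a - sqrt b)\<^sup>2 \<le> - ln b * a + b - a"
proof (cases "a = 0")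
  case False
  then have a: "a > 0" and b: "b > 0" using assms by (auto simp: less_le)
  define r where "r = sqrt b / sqrt a"
  have r: "r > 0" using a b by (simp add: r_def)
  have "ln r \<le> r - 1" using r by (rule ln_le_minus_one)
  moreover have "ln r = (ln b - ln a) / 2" using a b by (simp add: r_def ln_div ln_sqrt diff_divide_distrib)
  ultimately have "ln b - ln a \<le> 2 * (r - 1)" by simp
  then have "a * (ln b - ln a) \<le> a * (2 * (r - 1))" using a by (intro mult_left_mono) auto
  moreover have "a * r = sqrt a * sqrt b"
  proof -
    have "a * r = sqrt a * (sqrt a * r)" using a by (simp add: mult.assoc[symmetric])
    then show ?thesis using a by (simp add: r_def)
  qed
  moreover have "(sqrt a - sqrt b)\<^sup>2 = a + b - 2 * (sqrt a * sqrt b)"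
    using a b by (simp add: power2_diff)
  ultimately show ?thesis by (simp add: algebra_simps)
qed (use assms in auto)

text \<open>
  Averaging the previous bound at \<open>b\<close> equal to the mean \<open>m\<close> of \<open>X\<close> gives a gap of
  \<open>E (sqrt X - sqrt m)\<^sup>2\<close>. This dominates the variance of \<open>sqrt X\<close>, which is half of the mean
  square of the difference of two independent copies.
\<close>

lemma pmf_jensen_entropy:
  fixes \<mu> :: "'b pmf" and X :: "'b \<Rightarrow> real"
  assumes X: "\<And>s. 0 \<le> X s" "\<And>s. X s \<le> 1"
  defines "m \<equiv> \<integral>s. X s \<partial>measure_pmf \<mu>"
  shows "(\<integral>s. - ln (X s) * X s \<partial>measure_pmf \<mu>)
     + (\<integral>s. (\<integral>t. (sqrt (X s) - sqrt (X t))\<^sup>2 \<partial>measure_pmf \<mu>) \<partial>measure_pmf \<mu>) / 2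
     \<le> - ln m * m"
proof -
  have bdd: "integrable (measure_pmf \<mu>) g" if "\<And>s. \<bar>g s\<bar> \<le> B" for g :: "'b \<Rightarrow> real" and B
    by (rule measure_pmf.integrable_const_bound[of _ B]) (use that in auto)
  have iX: "integrable (measure_pmf \<mu>) X" by (rule bdd[of _ 1]) (use X in auto)
  have iS: "integrable (measure_pmf \<mu>) (\<lambda>s. sqrt (X s))"
    by (rule bdd[of _ 1]) (use X in auto)
  have iE: "integrable (measure_pmf \<mu>) (\<lambda>s. - ln (X s) * X s)"
    by (rule bdd[of _ 1]) (use X neg_ln_mult_bounds in blast)
  have m: "0 \<le> m" unfolding m_def using X by (intro Bochner_Integration.integral_nonneg) auto
  have zero: "X s = 0" if "m = 0" "s \<in> set_pmf \<mu>" for s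
  proof -
    have "AE s in measure_pmf \<mu>. X s = 0"
      using that(1) X iX by (simp add: m_def integral_nonneg_eq_0_iff_AE)
    then show ?thesis using that(2) by (simp add: AE_measure_pmf_iff)
  qed
  \<comment> \<open>The mean square of \<open>sqrt X - c\<close> is least when \<open>c\<close> is the mean \<open>w\<close> of \<open>sqrt X\<close>.\<close>
  define w where "w = (\<integral>s. sqrt (X s) \<partial>measure_pmf \<mu>)"
  have sq: "(sqrt (X s) - c)\<^sup>2 = X s - 2 * c * sqrt (X s) + c\<^sup>2" for s c
    using X by (simp add: power2_diff)
  have int_sq: "(\<integral>s. (sqrt (X s) - c)\<^sup>2 \<partial>measure_pmf \<mu>) = m - 2 * c * w + c\<^sup>2" for c
    using iX iS by (simp add: sq m_def w_def)
  have int_sq': "(\<integral>t. (sqrt (X s) - sqrt (X t))\<^sup>2 \<partial>measure_pmf \<mu>) = m - 2 * sqrt (X s) * w + X s" for s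
    using int_sq[of "sqrt (X s)"] X by (simp add: power2_commute)
  have "(\<integral>s. (\<integral>t. (sqrt (X s) - sqrt (X t))\<^sup>2 \<partial>measure_pmf \<mu>) \<partial>measure_pmf \<mu>) = 2 * m - 2 * w\<^sup>2"
    unfolding int_sq' using iX iS by (simp add: m_def[symmetric] w_def[symmetric] power2_eq_square)
  also have "\<dots> \<le> 2 * (m - 2 * sqrt m * w + (sqrt m)\<^sup>2)"
    using m zero_le_power2[of "sqrt m - w"] by (simp add: power2_diff)
  also have "\<dots> = 2 * (\<integral>s. (sqrt (X s) - sqrt m)\<^sup>2 \<partial>measure_pmf \<mu>)"
    by (simp only: int_sq)
  finally have var: "(\<integral>s. (\<integral>t. (sqrt (X s) - sqrt (X t))\<^sup>2 \<partial>measure_pmf \<mu>) \<partial>measure_pmf \<mu>) / 2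
      \<le> (\<integral>s. (sqrt (X s) - sqrt m)\<^sup>2 \<partial>measure_pmf \<mu>)" by simp
  have isq: "integrable (measure_pmf \<mu>) (\<lambda>s. (sqrt (X s) - sqrt m)\<^sup>2)"
    unfolding sq using iX iS by simp
  have "(\<integral>s. - ln (X s) * X s + (sqrt (X s) - sqrt m)\<^sup>2 \<partial>measure_pmf \<mu>)
      \<le> (\<integral>s. - ln m * X s + m - X s \<partial>measure_pmf \<mu>)"
  proof (intro integral_mono_AE AE_pmfI)
    fix s assume "s \<in> set_pmf \<mu>"
    then show "- ln (X s) * X s + (sqrt (X s) - sqrt m)\<^sup>2 \<le> - ln m * X s + m - X s"
      using X m zero by (intro entropy_gap_pointwise) auto
  qed (use iE isq iX in auto)
  also have "\<dots> = - ln m * m" using iX by (simp add: m_def[symmetric])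
  finally have "(\<integral>s. - ln (X s) * X s \<partial>measure_pmf \<mu>) + (\<integral>s. (sqrt (X s) - sqrt m)\<^sup>2 \<partial>measure_pmf \<mu>)
      \<le> - ln m * m"
    using iE isq by (simp add: Bochner_Integration.integral_add)
  then show ?thesis using var by linarith
qed

context marked_group begin

definition ent :: "'a pmf \<Rightarrow> ennreal" where
  "ent \<nu> = (\<integral>\<^sup>+x. ennreal (- ln (pmf \<nu> x) * pmf \<nu> x) \<partial>count_space (carrier G))"

definition drift :: "'a pmf \<Rightarrow> ennreal" where
  "drift \<nu> = (\<integral>\<^sup>+x. ennreal (real (wl x)) \<partial>measure_pmf \<nu>)"

text \<open>
  The mean squared \<open>\<ell>\<^sup>2\<close> distance between the square roots of two independent random translates of
  \<open>\<nu>\<close>, that is, a mean squared Hellinger distance.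
\<close>

definition fluct :: "'a pmf \<Rightarrow> 'a pmf \<Rightarrow> ennreal" where
  "fluct \<mu> \<nu> = (\<integral>\<^sup>+s. \<integral>\<^sup>+t. \<integral>\<^sup>+x. ennreal ((sqrt (pmf \<nu> (x \<otimes> inv s)) - sqrt (pmf \<nu> (x \<otimes> inv t)))\<^sup>2)
     \<partial>count_space (carrier G) \<partial>measure_pmf \<mu> \<partial>measure_pmf \<mu>)"

text \<open>
  The convolution is, at every point, a \<open>\<mu>\<close>-average of translates of \<open>\<nu>\<close>, and each translate has
  the same entropy as \<open>\<nu>\<close>. Comparing two independent translates, instead of a translate with \<open>\<nu>\<close>
  itself, makes this work for walks that are not lazy.
\<close>

lemma ent_convolution_ge:
  assumes mu: "set_pmf \<mu> \<subseteq> carrier G" and nu: "set_pmf \<nu> \<subseteq> carrier G"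
  shows "ent \<nu> + fluct \<mu> \<nu> / 2 \<le> ent (convolution G \<nu> \<mu>)"
proof -
  let ?X = "\<lambda>x s. pmf (right_shift G \<nu> s) x"
  let ?\<eta> = "\<lambda>t::real. - ln t * t"
  note \<eta> = neg_ln_mult_bounds(1) and \<eta>1 = neg_ln_mult_bounds(2)
  have conv: "pmf (convolution G \<nu> \<mu>) x = (\<integral>s. ?X x s \<partial>measure_pmf \<mu>)" for x
    by (simp add: convolution_eq_bind_shift pmf_bind)
  have bdd: "integrable (measure_pmf \<mu>) g" if "\<And>s. \<bar>g s\<bar> \<le> B" for g :: "'a \<Rightarrow> real" and B
    by (rule measure_pmf.integrable_const_bound[of _ B]) (use that in auto)
  have sq1: "(sqrt a - sqrt b)\<^sup>2 \<le> 1" if "0 \<le> a" "a \<le> 1" "0 \<le> b" "b \<le> 1" for a b :: real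
  proof -
    have "\<bar>sqrt a - sqrt b\<bar> \<le> 1" using that by (simp add: abs_le_iff) (smt (verit) real_sqrt_ge_0_iff real_sqrt_le_1_iff)
    then show ?thesis by (simp add: abs_square_le_1)
  qed
  have point: "(\<integral>\<^sup>+s. ennreal (?\<eta> (?X x s)) \<partial>measure_pmf \<mu>)
      + (\<integral>\<^sup>+s. \<integral>\<^sup>+t. ennreal ((sqrt (?X x s) - sqrt (?X x t))\<^sup>2) \<partial>measure_pmf \<mu> \<partial>measure_pmf \<mu>) / 2
      \<le> ennreal (?\<eta> (pmf (convolution G \<nu> \<mu>) x))" for x
  proof -
    have A: "(\<integral>\<^sup>+s. ennreal (?\<eta> (?X x s)) \<partial>measure_pmf \<mu>) = ennreal (\<integral>s. ?\<eta> (?X x s) \<partial>measure_pmf \<mu>)"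
      by (intro nn_integral_eq_integral bdd[of _ 1] AE_I2 \<eta> \<eta>1) (auto simp: pmf_le_1)
    have B: "(\<integral>\<^sup>+t. ennreal ((sqrt (?X x s) - sqrt (?X x t))\<^sup>2) \<partial>measure_pmf \<mu>)
        = ennreal (\<integral>t. (sqrt (?X x s) - sqrt (?X x t))\<^sup>2 \<partial>measure_pmf \<mu>)" for s
      by (intro nn_integral_eq_integral bdd[of _ 1] AE_I2) (auto simp: pmf_le_1 sq1)
    have C: "(\<integral>\<^sup>+s. ennreal (\<integral>t. (sqrt (?X x s) - sqrt (?X x t))\<^sup>2 \<partial>measure_pmf \<mu>) \<partial>measure_pmf \<mu>)
        = ennreal (\<integral>s. (\<integral>t. (sqrt (?X x s) - sqrt (?X x t))\<^sup>2 \<partial>measure_pmf \<mu>) \<partial>measure_pmf \<mu>)"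
    proof (intro nn_integral_eq_integral bdd[of _ 1] AE_I2)
      fix s
      have "(\<integral>t. (sqrt (?X x s) - sqrt (?X x t))\<^sup>2 \<partial>measure_pmf \<mu>) \<le> (\<integral>t. 1 \<partial>measure_pmf \<mu>)"
        by (intro integral_mono bdd[of _ 1]) (auto simp: pmf_le_1 sq1)
      then show "\<bar>\<integral>t. (sqrt (?X x s) - sqrt (?X x t))\<^sup>2 \<partial>measure_pmf \<mu>\<bar> \<le> 1"
        by (simp add: Bochner_Integration.integral_nonneg)
    qed (auto simp: Bochner_Integration.integral_nonneg)
    have "0 \<le> (\<integral>s. ?\<eta> (?X x s) \<partial>measure_pmf \<mu>)"
      by (intro Bochner_Integration.integral_nonneg \<eta>) (auto simp: pmf_le_1)
    moreover have "0 \<le> (\<integral>s. (\<integral>t. (sqrt (?X x s) - sqrt (?X x t))\<^sup>2 \<partial>measure_pmf \<mu>) \<partial>measure_pmf \<mu>)"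
      by (intro Bochner_Integration.integral_nonneg) auto
    moreover have "ennreal y / 2 = ennreal (y / 2)" if "0 \<le> y" for y
      using that divide_ennreal[of y 2] by simp
    ultimately show ?thesis
      unfolding A B C conv using pmf_jensen_entropy[of "?X x" \<mu>]
      by (simp add: ennreal_plus[symmetric] pmf_le_1 ennreal_leI del: ennreal_plus)
  qed
  have shift_int: "(\<integral>\<^sup>+x. ennreal (?\<eta> (?X x s)) \<partial>count_space (carrier G)) = ent \<nu>" if "s \<in> carrier G" for s
  proof -
    have "(\<integral>\<^sup>+x. ennreal (?\<eta> (?X x s)) \<partial>count_space (carrier G))
        = (\<integral>\<^sup>+x. ennreal (?\<eta> (?X (x \<otimes> s) s)) \<partial>count_space (carrier G))"
      by (rule nn_integral_bij_count_space[OF bij_betw_right_mult[OF that], symmetric])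
    also have "\<dots> = ent \<nu>" unfolding ent_def
      using that nu by (intro nn_integral_cong) (auto simp: pmf_shift m_assoc)
    finally show ?thesis .
  qed
  have E1: "(\<integral>\<^sup>+x. \<integral>\<^sup>+s. ennreal (?\<eta> (?X x s)) \<partial>measure_pmf \<mu> \<partial>count_space (carrier G)) = ent \<nu>"
  proof -
    have "(\<integral>\<^sup>+x. \<integral>\<^sup>+s. ennreal (?\<eta> (?X x s)) \<partial>measure_pmf \<mu> \<partial>count_space (carrier G))
        = (\<integral>\<^sup>+s. ent \<nu> \<partial>measure_pmf \<mu>)"
      unfolding nn_integral_pmf_count_space_swap
      using mu shift_int by (intro nn_integral_cong_AE) (auto simp: AE_measure_pmf_iff)
    then show ?thesis by simp
  qed
  have E2: "(\<integral>\<^sup>+x. \<integral>\<^sup>+s. \<integral>\<^sup>+t. ennreal ((sqrt (?X x s) - sqrt (?X x t))\<^sup>2)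
      \<partial>measure_pmf \<mu> \<partial>measure_pmf \<mu> \<partial>count_space (carrier G)) = fluct \<mu> \<nu>"
    unfolding nn_integral_pmf_count_space_swap fluct_def using mu nu
    by (intro nn_integral_cong_AE AE_pmfI) (auto simp: AE_measure_pmf_iff pmf_shift subset_iff intro!: nn_integral_cong_AE AE_pmfI nn_integral_cong)
  let ?A = "\<lambda>x. \<integral>\<^sup>+s. ennreal (?\<eta> (?X x s)) \<partial>measure_pmf \<mu>"
    and ?B = "\<lambda>x. \<integral>\<^sup>+s. \<integral>\<^sup>+t. ennreal ((sqrt (?X x s) - sqrt (?X x t))\<^sup>2) \<partial>measure_pmf \<mu> \<partial>measure_pmf \<mu>"
  have "ent \<nu> + fluct \<mu> \<nu> / 2
      = (\<integral>\<^sup>+x. ?A x \<partial>count_space (carrier G)) + (\<integral>\<^sup>+x. ?B x \<partial>count_space (carrier G)) / 2"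
    by (simp only: E1 E2)
  also have "\<dots> = (\<integral>\<^sup>+x. ?A x \<partial>count_space (carrier G)) + (\<integral>\<^sup>+x. ?B x / 2 \<partial>count_space (carrier G))"
    by (subst nn_integral_divide) auto
  also have "\<dots> = (\<integral>\<^sup>+x. ?A x + ?B x / 2 \<partial>count_space (carrier G))"
    by (rule nn_integral_add[symmetric]) auto
  also have "\<dots> \<le> ent (convolution G \<nu> \<mu>)"
    unfolding ent_def by (intro nn_integral_mono point)
  finally show ?thesis .
qed

end

section \<open>Fluctuations control drift increments\<close>

text \<open>
  With \<open>d = \<bar>sqrt a - sqrt b\<bar>\<close> and \<open>e = sqrt a + sqrt b\<close> one has \<open>\<bar>a - b\<bar> = d e\<close>, and \<open>d \<le> e\<close>
  allows to lower the power of \<open>d\<close> to \<open>2 \<theta>\<close>, raising that of \<open>e\<close> to \<open>2 (1 - \<theta>)\<close>. This leaves only the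
  moment of order \<open>1 / (1 - \<theta>)\<close> of \<open>T\<close>, which is at most 2. The free weight \<open>\<tau>\<close> stands in for
  Hoelder's inequality, both over the group and over time.
\<close>

lemma diff_sqrt_weighted_Young:
  fixes a b T \<tau> \<theta> :: real
  assumes ab: "0 \<le> a" "0 \<le> b" and T: "0 \<le> T" and lam: "0 < \<tau>" and th: "0 < \<theta>" "\<theta> \<le> 1 / 2"
  shows "T * \<bar>a - b\<bar> \<le> \<tau> * (sqrt a - sqrt b)\<^sup>2
      + \<tau> powr (- \<theta> / (1 - \<theta>)) * T powr (1 / (1 - \<theta>)) * (2 * (a + b))"
proof (cases "T = 0 \<or> a = b")
  case True
  then show ?thesis using assms by (auto intro!: mult_nonneg_nonneg add_nonneg_nonneg)
next
  case False
  then have T: "T > 0" and ne: "a \<noteq> b" using T by auto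
  define d e where "d = \<bar>sqrt a - sqrt b\<bar>" and "e = sqrt a + sqrt b"
  have d: "d > 0" using ne ab by (auto simp: d_def)
  have de: "d \<le> e" using ab by (simp add: d_def e_def abs_le_iff)
  have e: "e > 0" using d de by simp
  have prod: "\<bar>a - b\<bar> = d * e"
  proof -
    have "a - b = (sqrt a - sqrt b) * e" using ab by (simp add: e_def algebra_simps)
    then show ?thesis using e by (simp add: d_def abs_mult)
  qed
  define \<kappa> where "\<kappa> = \<tau> powr (- \<theta> / (1 - \<theta>)) * T powr (1 / (1 - \<theta>))"
  have k: "\<kappa> > 0" using lam T by (simp add: \<kappa>_def)
  have "d = d powr (2 * \<theta>) * d powr (1 - 2 * \<theta>)" using d by (simp add: powr_add[symmetric])
  also have "\<dots> \<le> d powr (2 * \<theta>) * e powr (1 - 2 * \<theta>)"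
    using d de th by (intro mult_left_mono powr_mono2) auto
  finally have "d * e \<le> d powr (2 * \<theta>) * e powr (1 - 2 * \<theta>) * e" using e by (intro mult_right_mono) auto
  also have "\<dots> = d powr (2 * \<theta>) * (e powr (1 - 2 * \<theta>) * e powr 1)" using e by simp
  also have "\<dots> = d powr (2 * \<theta>) * e powr (2 * (1 - \<theta>))"
    by (simp only: powr_add[symmetric]) (simp add: algebra_simps)
  finally have "T * \<bar>a - b\<bar> \<le> T * (d powr (2 * \<theta>) * e powr (2 * (1 - \<theta>)))"
    unfolding prod using T by (intro mult_left_mono) auto
  also have "\<dots> = (\<tau> * d\<^sup>2) powr \<theta> * (\<kappa> * e\<^sup>2) powr (1 - \<theta>)"
  proof -
    have "\<kappa> powr (1 - \<theta>) = \<tau> powr (- \<theta>) * T"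
      using th T lam by (simp add: \<kappa>_def powr_mult powr_powr)
    moreover have "(d\<^sup>2) powr \<theta> = d powr (2 * \<theta>)" "(e\<^sup>2) powr (1 - \<theta>) = e powr (2 * (1 - \<theta>))"
      using d e by (simp_all only: powr_powr[symmetric] powr_numeral)
    ultimately show ?thesis using lam k d e
      by (simp add: powr_mult powr_minus)
  qed
  also have "\<dots> \<le> \<theta> * (\<tau> * d\<^sup>2) + (1 - \<theta>) * (\<kappa> * e\<^sup>2)"
    using lam d k e th by (intro Youngs_inequality_0) auto
  also have "\<dots> \<le> 1 * (\<tau> * d\<^sup>2) + 1 * (\<kappa> * e\<^sup>2)"
    using lam k th by (intro add_mono mult_right_mono) auto
  also have "e\<^sup>2 \<le> 2 * (a + b)"
    using ab zero_le_power2[of "sqrt a - sqrt b"] by (simp add: e_def power2_sum power2_diff)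
  finally show ?thesis using k by (simp add: \<kappa>_def d_def mult_left_mono)
qed

lemma nn_integral_pmf_swap:
  "(\<integral>\<^sup>+s. \<integral>\<^sup>+t. f s t \<partial>measure_pmf N \<partial>measure_pmf M) = (\<integral>\<^sup>+t. \<integral>\<^sup>+s. f s t \<partial>measure_pmf M \<partial>measure_pmf N)"
proof -
  have "(\<integral>\<^sup>+s. \<integral>\<^sup>+t. f s t \<partial>measure_pmf N \<partial>measure_pmf M) = (\<integral>\<^sup>+z. f (fst z) (snd z) \<partial>pair_pmf M N)"
    by (simp add: nn_integral_pair_pmf')
  also have "\<dots> = (\<integral>\<^sup>+z. f (snd z) (fst z) \<partial>pair_pmf N M)"
    by (subst pair_commute_pmf) (simp add: case_prod_beta)
  finally show ?thesis by (simp add: nn_integral_pair_pmf')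
qed

context marked_group begin

lemma nn_integral_pmf_right_translate:
  assumes "set_pmf \<nu> \<subseteq> carrier G" "t \<in> carrier G"
  shows "(\<integral>\<^sup>+x. h x \<partial>measure_pmf \<nu>) =
    (\<integral>\<^sup>+x. h (x \<otimes> inv t) * ennreal (pmf \<nu> (x \<otimes> inv t)) \<partial>count_space (carrier G))"
proof -
  have "(\<integral>\<^sup>+x. h x \<partial>measure_pmf \<nu>) = (\<integral>\<^sup>+x. h x * ennreal (pmf \<nu> x) \<partial>count_space (carrier G))"
    unfolding nn_integral_measure_pmf using assms
    by (intro trans[OF nn_integral_count_space_eq nn_integral_cong]) (auto simp: pmf_outside mult.commute)
  also have "\<dots> = (\<integral>\<^sup>+x. h (x \<otimes> inv t) * ennreal (pmf \<nu> (x \<otimes> inv t)) \<partial>count_space (carrier G))"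
    using assms by (intro nn_integral_bij_count_space[OF bij_betw_right_mult, symmetric]) auto
  finally show ?thesis .
qed

text \<open>
  The two increments appear here as \<open>t\<close> and, by symmetry of \<open>\<mu>\<close>, the inverse of \<open>s\<close>; summing over
  the point \<open>x\<close> reached after the step \<open>t\<close> makes the expression comparable with the same one for
  \<open>s = t\<close>, which is the drift of \<open>\<nu>\<close>.
\<close>

lemma drift_two_steps:
  assumes sym: "symmetric_measure G \<mu>" and nu: "set_pmf \<nu> \<subseteq> carrier G"
  shows "drift (convolution G (convolution G \<nu> \<mu>) \<mu>) =
    (\<integral>\<^sup>+s. \<integral>\<^sup>+t. \<integral>\<^sup>+x. ennreal (real (wl (x \<otimes> inv s)) * pmf \<nu> (x \<otimes> inv t))
      \<partial>count_space (carrier G) \<partial>measure_pmf \<mu> \<partial>measure_pmf \<mu>)"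
proof -
  have mu: "set_pmf \<mu> \<subseteq> carrier G" using sym by (simp add: symmetric_measure_def)
  have "drift (convolution G (convolution G \<nu> \<mu>) \<mu>) =
      (\<integral>\<^sup>+s. \<integral>\<^sup>+t. \<integral>\<^sup>+y. ennreal (real (wl (y \<otimes> t \<otimes> s))) \<partial>measure_pmf \<nu> \<partial>measure_pmf \<mu> \<partial>measure_pmf \<mu>)"
    by (simp add: drift_def convolution_eq_bind_shift right_shift_def)
  also have "\<dots> = (\<integral>\<^sup>+s. \<integral>\<^sup>+t. \<integral>\<^sup>+y. ennreal (real (wl (y \<otimes> t \<otimes> s))) \<partial>measure_pmf \<nu> \<partial>measure_pmf \<mu>
      \<partial>measure_pmf (map_pmf (\<lambda>g. inv g) \<mu>))"
    by (simp only: symmetric_measure_map_inv[OF sym])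
  also have "\<dots> = (\<integral>\<^sup>+s. \<integral>\<^sup>+t. \<integral>\<^sup>+y. ennreal (real (wl (y \<otimes> t \<otimes> inv s))) \<partial>measure_pmf \<nu> \<partial>measure_pmf \<mu> \<partial>measure_pmf \<mu>)"
    by simp
  also have "\<dots> = (\<integral>\<^sup>+s. \<integral>\<^sup>+t. \<integral>\<^sup>+x. ennreal (real (wl (x \<otimes> inv s)) * pmf \<nu> (x \<otimes> inv t))
      \<partial>count_space (carrier G) \<partial>measure_pmf \<mu> \<partial>measure_pmf \<mu>)"
  proof (intro nn_integral_cong_AE AE_pmfI)
    fix s t assume "s \<in> set_pmf \<mu>" "t \<in> set_pmf \<mu>"
    then have st: "s \<in> carrier G" "t \<in> carrier G" using mu by auto
    show "(\<integral>\<^sup>+y. ennreal (real (wl (y \<otimes> t \<otimes> inv s))) \<partial>measure_pmf \<nu>) =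
      (\<integral>\<^sup>+x. ennreal (real (wl (x \<otimes> inv s)) * pmf \<nu> (x \<otimes> inv t)) \<partial>count_space (carrier G))"
      unfolding nn_integral_pmf_right_translate[OF nu st(2)]
      using st by (intro nn_integral_cong) (auto simp: m_assoc ennreal_mult')
  qed
  finally show ?thesis .
qed

text \<open>
  Write \<open>u\<close>, \<open>a\<close> for the length and the mass at \<open>x \<otimes> inv s\<close>, and \<open>u'\<close>, \<open>a'\<close> for those at
  \<open>x \<otimes> inv t\<close>. The drift gained in two steps is the sum of \<open>u a' - u a\<close>. Exchanging \<open>s\<close> and
  \<open>t\<close> turns twice this into the sum of \<open>(u - u') (a' - a)\<close>, in which the lengths differ by at most
  \<open>wl s + wl t\<close> and the masses by an amount that the fluctuation controls. All terms are moved to the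
  side where they are positive, so that no sum has to be known to converge.
\<close>

lemma drift_two_steps_le:
  assumes sym: "symmetric_measure G \<mu>" and nu: "set_pmf \<nu> \<subseteq> carrier G"
    and lam: "0 < \<tau>" and th: "0 < \<theta>" "\<theta> \<le> 1 / 2" and W0: "0 \<le> W"
    and W: "(\<integral>\<^sup>+s. \<integral>\<^sup>+t. ennreal ((real (wl s) + real (wl t)) powr (1 / (1 - \<theta>))) \<partial>measure_pmf \<mu> \<partial>measure_pmf \<mu>) \<le> ennreal W"
  shows "drift (convolution G (convolution G \<nu> \<mu>) \<mu>)
    \<le> drift \<nu> + ennreal \<tau> * (fluct \<mu> \<nu> / 2) + ennreal (2 * \<tau> powr (- \<theta> / (1 - \<theta>)) * W)"
proof -
  have mu: "set_pmf \<mu> \<subseteq> carrier G" using sym by (simp add: symmetric_measure_def)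
  define \<kappa> where "\<kappa> = \<tau> powr (- \<theta> / (1 - \<theta>))"
  have k: "\<kappa> \<ge> 0" by (simp add: \<kappa>_def)
  let ?D2 = "drift (convolution G (convolution G \<nu> \<mu>) \<mu>)"
  let ?C = "count_space (carrier G)"
  let ?u = "\<lambda>s x. real (wl (x \<otimes> inv s))" and ?a = "\<lambda>s x. pmf \<nu> (x \<otimes> inv s)"
  let ?T = "\<lambda>s t. (real (wl s) + real (wl t)) powr (1 / (1 - \<theta>))"
  let ?d = "\<lambda>s t x. (sqrt (?a s x) - sqrt (?a t x))\<^sup>2"
  have real_ineq: "?u s x * ?a t x + ?u t x * ?a s x \<le> ?u s x * ?a s x + ?u t x * ?a t x
       + \<tau> * ?d s t x + \<kappa> * ?T s t * (2 * (?a s x + ?a t x))"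
    if st: "s \<in> carrier G" "t \<in> carrier G" and x: "x \<in> carrier G" for s t x
  proof -
    have "?u s x \<le> ?u t x + (real (wl t) + real (wl s))" if "s \<in> carrier G" "t \<in> carrier G" for s t
    proof -
      have "x \<otimes> inv s = x \<otimes> inv t \<otimes> (t \<otimes> inv s)"
        using that x by (simp add: m_assoc[symmetric]) (simp add: m_assoc)
      then have "wl (x \<otimes> inv s) \<le> wl (x \<otimes> inv t) + wl (t \<otimes> inv s)"
        using wl_mult_le[of "x \<otimes> inv t" "t \<otimes> inv s"] that x by simp
      also have "wl (t \<otimes> inv s) \<le> wl t + wl (inv s)" using that by (intro wl_mult_le) auto
      also have "wl (inv s) \<le> wl s" using that by (intro wl_inv_le)
      finally show ?thesis by simp
    qed
    from this[OF st] this[OF st(2,1)]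
    have "\<bar>?u s x - ?u t x\<bar> \<le> real (wl s) + real (wl t)" by (simp add: abs_le_iff)
    then have "\<bar>?u s x - ?u t x\<bar> * \<bar>?a t x - ?a s x\<bar> \<le> (real (wl s) + real (wl t)) * \<bar>?a s x - ?a t x\<bar>"
      by (subst abs_minus_commute[of "?a t x"]) (intro mult_right_mono, auto)
    moreover have "(?u s x - ?u t x) * (?a t x - ?a s x) \<le> \<bar>?u s x - ?u t x\<bar> * \<bar>?a t x - ?a s x\<bar>"
      by (simp add: abs_mult[symmetric])
    moreover have "(real (wl s) + real (wl t)) * \<bar>?a s x - ?a t x\<bar> \<le> \<tau> * ?d s t x + \<kappa> * ?T s t * (2 * (?a s x + ?a t x))"
      unfolding \<kappa>_def using lam th by (intro diff_sqrt_weighted_Young) auto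
    ultimately have "(?u s x - ?u t x) * (?a t x - ?a s x) \<le> \<tau> * ?d s t x + \<kappa> * ?T s t * (2 * (?a s x + ?a t x))"
      by linarith
    then show ?thesis by (simp add: algebra_simps)
  qed
  let ?P = "\<lambda>f. (\<integral>\<^sup>+s. \<integral>\<^sup>+t. \<integral>\<^sup>+x. f s t x \<partial>?C \<partial>measure_pmf \<mu> \<partial>measure_pmf \<mu>)"
  have P_add: "?P (\<lambda>s t x. f s t x + g s t x) = ?P f + ?P g" for f g :: "'a \<Rightarrow> 'a \<Rightarrow> 'a \<Rightarrow> ennreal"
    by (simp add: nn_integral_add)
  have P_cmult: "?P (\<lambda>s t x. c * f s t x) = c * ?P f" for f :: "'a \<Rightarrow> 'a \<Rightarrow> 'a \<Rightarrow> ennreal" and c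
    by (simp add: nn_integral_cmult)
  have P_swap: "?P (\<lambda>s t x. f t s x) = ?P f" for f :: "'a \<Rightarrow> 'a \<Rightarrow> 'a \<Rightarrow> ennreal"
    by (rule nn_integral_pmf_swap)
  have mass: "(\<integral>\<^sup>+x. ennreal (?a s x) \<partial>?C) = 1" if "s \<in> carrier G" for s
    using nn_integral_pmf_right_translate[OF nu that, of "\<lambda>_. 1"] by simp
  have D2: "?P (\<lambda>s t x. ennreal (?u s x * ?a t x)) = ?D2"
    by (rule drift_two_steps[OF sym nu, symmetric])
  have D0: "?P (\<lambda>s t x. ennreal (?u s x * ?a s x)) = drift \<nu>"
  proof -
    have "?P (\<lambda>s t x. ennreal (?u s x * ?a s x)) = (\<integral>\<^sup>+s. \<integral>\<^sup>+t. drift \<nu> \<partial>measure_pmf \<mu> \<partial>measure_pmf \<mu>)"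
      unfolding drift_def using mu
      by (intro nn_integral_cong_AE AE_pmfI) (auto simp: nn_integral_pmf_right_translate[OF nu] ennreal_mult' subset_iff)
    then show ?thesis by simp
  qed
  have PT: "?P (\<lambda>s t x. ennreal (?T s t * (2 * (?a s x + ?a t x)))) \<le> ennreal (4 * W)"
  proof -
    have "?P (\<lambda>s t x. ennreal (?T s t * (2 * (?a s x + ?a t x)))) =
        (\<integral>\<^sup>+s. \<integral>\<^sup>+t. 4 * ennreal (?T s t) \<partial>measure_pmf \<mu> \<partial>measure_pmf \<mu>)"
    proof (intro nn_integral_cong_AE AE_pmfI)
      fix s t assume "s \<in> set_pmf \<mu>" "t \<in> set_pmf \<mu>"
      then have st: "s \<in> carrier G" "t \<in> carrier G" using mu by auto
      have "(\<integral>\<^sup>+x. ennreal (?T s t * (2 * (?a s x + ?a t x))) \<partial>?C) =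
          (\<integral>\<^sup>+x. ennreal (?T s t) * (2 * (ennreal (?a s x) + ennreal (?a t x))) \<partial>?C)"
        by (intro nn_integral_cong) (simp add: ennreal_mult)
      also have "\<dots> = ennreal (?T s t) * (2 * (1 + 1))"
        by (simp add: nn_integral_cmult nn_integral_add mass st)
      finally show "(\<integral>\<^sup>+x. ennreal (?T s t * (2 * (?a s x + ?a t x))) \<partial>?C) = 4 * ennreal (?T s t)"
        by (simp add: mult.commute)
    qed
    also have "\<dots> = 4 * (\<integral>\<^sup>+s. \<integral>\<^sup>+t. ennreal (?T s t) \<partial>measure_pmf \<mu> \<partial>measure_pmf \<mu>)"
      by (simp add: nn_integral_cmult)
    also have "\<dots> \<le> 4 * ennreal W" by (intro mult_left_mono W) auto
    finally show ?thesis using W0 by (simp add: ennreal_mult)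
  qed
  have "?D2 + ?D2 = ?P (\<lambda>s t x. ennreal (?u s x * ?a t x)) + ?P (\<lambda>s t x. ennreal (?u t x * ?a s x))"
    using P_swap[of "\<lambda>s t x. ennreal (?u s x * ?a t x)"] D2 by simp
  also have "\<dots> = ?P (\<lambda>s t x. ennreal (?u s x * ?a t x) + ennreal (?u t x * ?a s x))"
    by (rule P_add[symmetric])
  also have "\<dots> \<le> ?P (\<lambda>s t x. (ennreal (?u s x * ?a s x) + ennreal (?u t x * ?a t x))
      + (ennreal \<tau> * ennreal (?d s t x) + ennreal \<kappa> * ennreal (?T s t * (2 * (?a s x + ?a t x)))))"
  proof (rule nn_integral_mono_AE, rule AE_pmfI, rule nn_integral_mono_AE, rule AE_pmfI, rule nn_integral_mono)
    fix s t x assume "s \<in> set_pmf \<mu>" "t \<in> set_pmf \<mu>" "x \<in> space ?C"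
    then have st: "s \<in> carrier G" "t \<in> carrier G" "x \<in> carrier G" using mu by auto
    have "ennreal (?u s x * ?a t x + ?u t x * ?a s x) \<le> ennreal (?u s x * ?a s x + ?u t x * ?a t x
       + (\<tau> * ?d s t x + \<kappa> * (?T s t * (2 * (?a s x + ?a t x)))))"
      using real_ineq[OF st] by (intro ennreal_leI) (simp add: mult.assoc)
    also have "\<dots> = (ennreal (?u s x * ?a s x) + ennreal (?u t x * ?a t x))
      + (ennreal \<tau> * ennreal (?d s t x) + ennreal \<kappa> * ennreal (?T s t * (2 * (?a s x + ?a t x))))"
      using lam k by (simp add: ennreal_mult'[symmetric])
    finally show "ennreal (?u s x * ?a t x) + ennreal (?u t x * ?a s x) \<le> \<dots>" by simp
  qed
  also have "\<dots> = (drift \<nu> + drift \<nu>) + (ennreal \<tau> * fluct \<mu> \<nu>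
      + ennreal \<kappa> * ?P (\<lambda>s t x. ennreal (?T s t * (2 * (?a s x + ?a t x)))))"
    unfolding P_add P_cmult D0 P_swap[of "\<lambda>s t x. ennreal (?u s x * ?a s x)"] fluct_def ..
  also have "\<dots> \<le> (drift \<nu> + drift \<nu>) + (ennreal \<tau> * fluct \<mu> \<nu> + ennreal \<kappa> * ennreal (4 * W))"
    by (intro add_left_mono mult_left_mono PT) auto
  finally have two: "?D2 + ?D2 \<le> (drift \<nu> + drift \<nu>) + (ennreal \<tau> * fluct \<mu> \<nu> + ennreal \<kappa> * ennreal (4 * W))" .
  have half: "(x + x) / 2 = x" for x :: ennreal
    by (simp add: mult_2[symmetric] ennreal_mult_divide_eq mult.commute)
  have split: "((x + x) + (y + z)) / 2 = x + (y / 2 + z / 2)" for x y z :: ennreal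
    by (simp only: add_divide_distrib_ennreal[of "x + x" "y + z"] add_divide_distrib_ennreal[of y z] half)
  have "?D2 = (?D2 + ?D2) / 2" by (simp only: half)
  also have "\<dots> \<le> ((drift \<nu> + drift \<nu>) + (ennreal \<tau> * fluct \<mu> \<nu> + ennreal \<kappa> * ennreal (4 * W))) / 2"
    by (rule divide_right_mono_ennreal[OF two])
  also have "\<dots> = drift \<nu> + (ennreal \<tau> * (fluct \<mu> \<nu> / 2) + ennreal \<kappa> * ennreal (4 * W) / 2)"
    unfolding split by (simp add: ennreal_times_divide)
  also have "ennreal \<kappa> * ennreal (4 * W) / 2 = ennreal (2 * \<kappa> * W)"
    using k W0 divide_ennreal[of "\<kappa> * (4 * W)" 2] by (simp add: ennreal_mult'[symmetric] mult_ac)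
  finally show ?thesis by (simp add: \<kappa>_def add.assoc)
qed

end

section \<open>Choice of scales\<close>

text \<open>
  Potter's bound. Far out, doubling the argument multiplies \<open>f\<close> by at most \<open>2 powr \<delta>\<close>, and this is
  iterated; monotonicity covers the remaining bounded range and the arguments between powers of 2.
\<close>

lemma slowly_varying_Potter:
  assumes sv: "slowly_varying f" and mono: "mono_on {1..} f" and d: "0 < \<delta>"
  obtains C where "0 < C" "\<And>x t. 1 \<le> x \<Longrightarrow> 1 \<le> t \<Longrightarrow> f (t * x) \<le> C * t powr \<delta> * f x"
proof -
  have pos: "f x > 0" if "1 \<le> x" for x using sv that by (auto simp: slowly_varying_def)
  have "((\<lambda>x. f (2 * x) / f x) \<longlongrightarrow> 1) at_top" using sv by (simp add: slowly_varying_def)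
  moreover have "1 < (2::real) powr \<delta>" using d by simp
  ultimately have "eventually (\<lambda>x. f (2 * x) / f x < 2 powr \<delta>) at_top"
    by (rule order_tendstoD)
  then obtain x0' where x0': "\<And>x. x \<ge> x0' \<Longrightarrow> f (2 * x) / f x < 2 powr \<delta>"
    by (auto simp: eventually_at_top_linorder)
  define x0 where "x0 = max 1 x0'"
  have x0: "1 \<le> x0" and dbl: "\<And>x. x \<ge> x0 \<Longrightarrow> f (2 * x) \<le> 2 powr \<delta> * f x"
    using x0' pos by (force simp: x0_def field_simps)+
  have iter: "f (2 ^ j * x) \<le> (2 powr \<delta>) ^ j * f x" if "x \<ge> x0" for j x
  proof (induction j)
    case (Suc j)
    have "x0 * 1 \<le> x * 2 ^ j" using that x0 by (intro mult_mono) auto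
    then have "f (2 * (2 ^ j * x)) \<le> 2 powr \<delta> * f (2 ^ j * x)" by (intro dbl) (simp add: mult.commute)
    also have "\<dots> \<le> 2 powr \<delta> * ((2 powr \<delta>) ^ j * f x)" using Suc by (intro mult_left_mono) auto
    finally show ?case by (simp add: mult.assoc)
  qed simp
  define C where "C = 2 powr \<delta> * (f x0 / f 1)"
  show thesis
  proof (rule that[of C])
    show C: "0 < C" using pos x0 by (simp add: C_def)
    fix x t :: real assume x: "1 \<le> x" and t: "1 \<le> t"
    define j where "j = nat \<lceil>log 2 t\<rceil>"
    have j: "log 2 t \<le> real j" "real j \<le> log 2 t + 1"
      using t by (auto simp: j_def zero_le_log_cancel_iff)
    have "t = 2 powr (log 2 t)" using t by simp
    also have "\<dots> \<le> 2 powr real j" using j by (intro powr_mono) auto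
    finally have tj: "t \<le> 2 ^ j" by (simp add: powr_realpow)
    have "(2 powr \<delta>) ^ j = 2 powr (\<delta> * real j)" by (simp add: powr_powr powr_realpow[symmetric])
    also have "\<dots> \<le> 2 powr (\<delta> * (log 2 t + 1))" using j d by (intro powr_mono mult_left_mono) auto
    also have "\<dots> = 2 powr \<delta> * t powr \<delta>" 
      using t by (simp add: powr_def log_def algebra_simps exp_add)
    finally have jt: "(2 powr \<delta>) ^ j \<le> 2 powr \<delta> * t powr \<delta>" .
    define y where "y = max x x0"
    have y: "1 \<le> y" "x \<le> y" "x0 \<le> y" using x by (auto simp: y_def)
    have "f y \<le> f x0 / f 1 * f x"
    proof (cases "x0 \<le> x")
      case True
      have "f 1 \<le> f x0" using mono x0 by (auto simp: mono_on_def)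
      then have "1 \<le> f x0 / f 1" using pos[of 1] by simp
      then have "1 * f x \<le> f x0 / f 1 * f x" using pos[OF x] by (intro mult_right_mono) auto
      then show ?thesis using True by (simp add: y_def)
    next
      case False
      have "f 1 \<le> f x" using mono x by (auto simp: mono_on_def)
      then have "f x0 * f 1 \<le> f x0 * f x" using pos[OF x0] by (intro mult_left_mono) auto
      then show ?thesis using False pos[of 1] by (simp add: y_def field_simps)
    qed
    have "1 * 1 \<le> t * x" "t * x \<le> 2 ^ j * y" using x t y tj by (intro mult_mono; simp)+
    then have "f (t * x) \<le> f (2 ^ j * y)" using mono by (intro mono_onD[of "{1..}" f]) auto
    also have "\<dots> \<le> (2 powr \<delta>) ^ j * f y" by (rule iter) (use y in simp)
    also have "\<dots> \<le> (2 powr \<delta> * t powr \<delta>) * (f x0 / f 1 * f x)"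
      using jt \<open>f y \<le> f x0 / f 1 * f x\<close> pos[OF y(1)] by (intro mult_mono) auto
    finally show "f (t * x) \<le> C * t powr \<delta> * f x" by (simp add: C_def mult_ac)
  qed
qed

text \<open>
  At time \<open>x\<close> the basic scale is \<open>R = D * x powr \<alpha> * \<omega> x\<close>. Since \<open>\<omega>\<close> grows slower than the power
  \<open>\<alpha> * (\<eta> - 1)\<close>, \<open>R\<close> is at most of order \<open>x powr (\<alpha> * \<eta>)\<close>, and there \<open>\<l>\<close> is controlled by \<open>\<omega>\<close>: the
  escape bound \<open>x * \<l> R / R powr (1 / \<alpha>)\<close> is therefore bounded. At scale \<open>2 ^ j * R\<close> it decays like
  \<open>2 powr (- j / \<alpha>)\<close> up to the growth of \<open>\<l>\<close>, hence faster than \<open>2 powr (- j)\<close>.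
\<close>

lemma exists_scale_constants:
  fixes \<l> \<omega> :: "real \<Rightarrow> real"
  assumes \<alpha>: "0 < \<alpha>" "\<alpha> < 1"
    and svl: "slowly_varying \<l>" "mono_on {1..} \<l>"
    and svo: "slowly_varying \<omega>" "mono_on {1..} \<omega>"
    and \<eta>: "1 < \<eta>" and dom: "\<And>y. 1 \<le> y \<Longrightarrow> \<l> (y powr (\<alpha> * \<eta>)) powr \<alpha> \<le> \<omega> y"
  obtains D K b where "0 < D" "0 \<le> K" "1 < b"
    "\<And>x. 1 \<le> x \<Longrightarrow> 2 \<le> D * x powr \<alpha> * \<omega> x"
    "\<And>x j. 1 \<le> x \<Longrightarrow> x * (\<l> (2 ^ j * (D * x powr \<alpha> * \<omega> x)) / (2 ^ j * (D * x powr \<alpha> * \<omega> x)) powr (1 / \<alpha>))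
        \<le> K * 2 powr (- b * real j)"
proof -
  have lpos: "\<l> x > 0" if "1 \<le> x" for x using svl that by (auto simp: slowly_varying_def)
  have opos: "\<omega> x > 0" if "1 \<le> x" for x using svo that by (auto simp: slowly_varying_def)
  \<comment> \<open>Half of the room between the decay exponent \<open>1 / \<alpha>\<close> and the critical value 1.\<close>
  define \<delta> where "\<delta> = (1 / \<alpha> - 1) / 2"
  have d: "\<delta> > 0" using \<alpha> by (simp add: \<delta>_def)
  obtain A where A: "0 < A" "\<And>x t. 1 \<le> x \<Longrightarrow> 1 \<le> t \<Longrightarrow> \<l> (t * x) \<le> A * t powr \<delta> * \<l> x"
    using slowly_varying_Potter[OF svl d] by blast
  have "0 < \<alpha> * (\<eta> - 1)" using \<alpha> \<eta> by simp
  from slowly_varying_Potter[OF svo this]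
  obtain B where B: "0 < B" "\<And>x t. 1 \<le> x \<Longrightarrow> 1 \<le> t \<Longrightarrow> \<omega> (t * x) \<le> B * t powr (\<alpha> * (\<eta> - 1)) * \<omega> x"
    by blast
  \<comment> \<open>Large enough for \<open>R \<ge> 2\<close>, which makes \<open>exp R - exp 1\<close> an admissible volume.\<close>
  define D where "D = max 1 (2 / \<omega> 1)"
  have D: "1 \<le> D" "2 / \<omega> 1 \<le> D" by (auto simp: D_def)
  define t0 where "t0 = max 1 (D * (B * \<omega> 1))"
  have t0: "1 \<le> t0" "D * (B * \<omega> 1) \<le> t0" by (auto simp: t0_def)
  define K where "K = A * (A * t0 powr \<delta>)"
  have two: "2 \<le> D * x powr \<alpha> * \<omega> x" if x: "1 \<le> x" for x
  proof -
    have "2 = 2 / \<omega> 1 * 1 * \<omega> 1" using opos[of 1] by simp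
    also have "\<dots> \<le> D * x powr \<alpha> * \<omega> x"
      using D x \<alpha> opos[of 1] svo(2)
      by (intro mult_mono) (auto simp: ge_one_powr_ge_zero mono_on_def)
    finally show ?thesis .
  qed
  show thesis
  proof (rule that[of D K "1 / \<alpha> - \<delta>"])
    show "0 < D" using D by simp
    show "0 \<le> K" using A(1) by (simp add: K_def)
    show "1 < 1 / \<alpha> - \<delta>" using \<alpha> by (simp add: \<delta>_def field_simps)
    show "2 \<le> D * x powr \<alpha> * \<omega> x" if "1 \<le> x" for x by (rule two[OF that])
    fix x :: real and j :: nat assume x: "1 \<le> x"
    define R where "R = D * x powr \<alpha> * \<omega> x"
    have R: "2 \<le> R" using two[OF x] by (simp add: R_def)
    have xx: "1 \<le> x powr (\<alpha> * \<eta>)" using x \<alpha> \<eta> by (simp add: ge_one_powr_ge_zero)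
    have "\<omega> x \<le> B * x powr (\<alpha> * (\<eta> - 1)) * \<omega> 1" using B(2)[of 1 x] x by simp
    then have "R \<le> D * x powr \<alpha> * (B * x powr (\<alpha> * (\<eta> - 1)) * \<omega> 1)"
      unfolding R_def using D by (intro mult_left_mono) auto
    also have "\<dots> = D * (B * \<omega> 1) * (x powr \<alpha> * x powr (\<alpha> * (\<eta> - 1)))" by simp
    also have "x powr \<alpha> * x powr (\<alpha> * (\<eta> - 1)) = x powr (\<alpha> * \<eta>)"
      by (simp add: powr_add[symmetric] algebra_simps)
    also have "D * (B * \<omega> 1) * x powr (\<alpha> * \<eta>) \<le> t0 * x powr (\<alpha> * \<eta>)"
      using t0 by (intro mult_right_mono) auto
    finally have Rle: "R \<le> t0 * x powr (\<alpha> * \<eta>)" .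
    have "\<l> R \<le> \<l> (t0 * x powr (\<alpha> * \<eta>))"
      using Rle R by (intro mono_onD[OF svl(2)]) auto
    also have "\<dots> \<le> A * t0 powr \<delta> * \<l> (x powr (\<alpha> * \<eta>))" by (rule A(2)[OF xx t0(1)])
    also have "\<l> (x powr (\<alpha> * \<eta>)) \<le> \<omega> x powr (1 / \<alpha>)"
    proof -
      have "(\<l> (x powr (\<alpha> * \<eta>)) powr \<alpha>) powr (1 / \<alpha>) \<le> \<omega> x powr (1 / \<alpha>)"
        using dom[OF x] \<alpha> by (intro powr_mono2) auto
      then show ?thesis using lpos[OF xx] \<alpha> by (simp add: powr_powr)
    qed
    finally have lR: "\<l> R \<le> A * t0 powr \<delta> * \<omega> x powr (1 / \<alpha>)" using A(1) by (simp add: mult_left_mono)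
    have "\<l> (2 ^ j * R) \<le> A * (2 ^ j) powr \<delta> * \<l> R" using R by (intro A(2)) auto
    also have "\<dots> \<le> A * (2 ^ j) powr \<delta> * (A * t0 powr \<delta> * \<omega> x powr (1 / \<alpha>))"
      using A(1) lR by (intro mult_left_mono) auto
    also have "\<dots> = K * (2 powr (\<delta> * real j)) * \<omega> x powr (1 / \<alpha>)"
      by (simp add: K_def powr_realpow[symmetric] powr_powr mult_ac)
    finally have num: "\<l> (2 ^ j * R) \<le> K * (2 powr (\<delta> * real j)) * \<omega> x powr (1 / \<alpha>)" .
    have "2 powr (real j / \<alpha>) * (x * \<omega> x powr (1 / \<alpha>)) = 2 powr (real j / \<alpha>) * (1 * x * \<omega> x powr (1 / \<alpha>))" by simp
    also have "\<dots> \<le> 2 powr (real j / \<alpha>) * (D powr (1 / \<alpha>) * x * \<omega> x powr (1 / \<alpha>))"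
      using D \<alpha> x by (intro mult_left_mono mult_right_mono ge_one_powr_ge_zero) auto
    also have "\<dots> = (2 ^ j * R) powr (1 / \<alpha>)"
      using D x opos[OF x] \<alpha> by (simp add: R_def powr_mult powr_powr powr_realpow[symmetric])
    finally have den: "2 powr (real j / \<alpha>) * (x * \<omega> x powr (1 / \<alpha>)) \<le> (2 ^ j * R) powr (1 / \<alpha>)" .
    have "x * (\<l> (2 ^ j * R) / (2 ^ j * R) powr (1 / \<alpha>))
        \<le> x * (K * (2 powr (\<delta> * real j)) * \<omega> x powr (1 / \<alpha>) / (2 powr (real j / \<alpha>) * (x * \<omega> x powr (1 / \<alpha>))))"
      using x opos[OF x] R A(1) num den by (intro mult_left_mono frac_le) (auto simp: K_def)
    also have "\<dots> = K * (2 powr (\<delta> * real j) / 2 powr (real j / \<alpha>))"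
      using x opos[OF x] by simp
    also have "\<dots> = K * 2 powr (- (1 / \<alpha> - \<delta>) * real j)"
      by (simp add: powr_diff[symmetric] algebra_simps)
    finally show "x * (\<l> (2 ^ j * (D * x powr \<alpha> * \<omega> x)) / (2 ^ j * (D * x powr \<alpha> * \<omega> x)) powr (1 / \<alpha>))
        \<le> K * 2 powr (- (1 / \<alpha> - \<delta>) * real j)"
      by (simp only: R_def)
  qed
qed

section \<open>Growth of entropy and drift\<close>

context marked_group begin

lemma entropy_at_eq_ent: "entropy_at G \<mu> n = ent (conv_power G \<mu> n)"
  by (simp add: entropy_at_def ent_def nn_integral_count_space_eq_infsum)

lemma drift_at_eq_drift:
  assumes "set_pmf \<mu> \<subseteq> carrier G"
  shows "drift_at G S \<mu> n = drift (conv_power G \<mu> n)"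
proof -
  have "drift (conv_power G \<mu> n) = (\<integral>\<^sup>+x. ennreal (real (wl x) * pmf (conv_power G \<mu> n) x) \<partial>count_space (carrier G))"
    unfolding drift_def nn_integral_measure_pmf using set_conv_power[OF assms, of n]
    by (intro trans[OF nn_integral_count_space_eq nn_integral_cong]) (auto simp: pmf_outside ennreal_mult' mult.commute)
  then show ?thesis by (simp add: drift_at_def nn_integral_count_space_eq_infsum)
qed

lemma finite_moment_integral:
  assumes mu: "set_pmf \<mu> \<subseteq> carrier G" and mom: "finite_moment G S p \<mu>"
  obtains M where "0 \<le> M" "(\<integral>\<^sup>+g. ennreal (real (wl g) powr p) \<partial>measure_pmf \<mu>) = ennreal M"
    "integrable (measure_pmf \<mu>) (\<lambda>g. real (wl g) powr p)"
proof -
  let ?f = "\<lambda>g. real (wl g) powr p * pmf \<mu> g"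
  have summ: "?f summable_on carrier G" using mom by (simp add: finite_moment_def)
  have "(\<integral>\<^sup>+g. ennreal (real (wl g) powr p) \<partial>measure_pmf \<mu>) = (\<integral>\<^sup>+g. ennreal (?f g) \<partial>count_space (carrier G))"
    unfolding nn_integral_measure_pmf using mu
    by (intro trans[OF nn_integral_count_space_eq nn_integral_cong]) (auto simp: pmf_outside ennreal_mult' mult.commute)
  also have "\<dots> = (\<Sum>\<^sub>\<infinity>g\<in>carrier G. ennreal (?f g))" by (rule nn_integral_count_space_eq_infsum)
  also have "\<dots> \<le> ennreal (infsum ?f (carrier G))"
  proof (rule infsum_le_finite_sums)
    fix F assume F: "finite F" "F \<subseteq> carrier G"
    show "(\<Sum>g\<in>F. ennreal (?f g)) \<le> ennreal (infsum ?f (carrier G))"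
      using F by (subst sum_ennreal) (auto intro!: ennreal_leI finite_sum_le_infsum summ)
  qed (auto intro: nonneg_summable_on_complete)
  finally have fin: "(\<integral>\<^sup>+g. ennreal (real (wl g) powr p) \<partial>measure_pmf \<mu>) < \<top>"
    by (rule le_less_trans) simp
  have int: "integrable (measure_pmf \<mu>) (\<lambda>g. real (wl g) powr p)"
    using fin by (intro integrableI_bounded) auto
  show thesis
    by (rule that[of "\<integral>g. real (wl g) powr p \<partial>measure_pmf \<mu>"])
       (auto intro!: nn_integral_eq_integral int)
qed

text \<open>
  The infimum defining the profile need not be attained; a factor 2 is spent on a function that
  nearly attains it.
\<close>

lemma good_set_of_profile:
  assumes p: "1 \<le> p" "p \<le> 2" and sym: "symmetric_measure G \<mu>"
    and mom: "integrable (measure_pmf \<mu>) (\<lambda>g. real (wl g) powr p)"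
    and prof: "spectral_profile G p (unif_gens G S) v \<le> ennreal B" and B: "0 < B"
  shows "\<exists>A. finite A \<and> A \<subseteq> carrier G \<and> real (card A) \<le> 2 * v \<and>
    (\<forall>n. measure (measure_pmf (conv_power G \<mu> n)) (- A)
        \<le> real n * (4 * real (card (sym_gens G S)) * B) * (\<integral>g. real (wl g) powr p \<partial>measure_pmf \<mu>))"
proof -
  have "spectral_profile G p (unif_gens G S) v < ennreal (2 * B)"
    using prof by (rule le_less_trans) (use B in \<open>simp add: ennreal_less_iff\<close>)
  then obtain f where f: "finite (support_on G f)" "real (card (support_on G f)) \<le> v" "lp_norm G p f = 1"
    and E: "energy G p (unif_gens G S) f < ennreal (2 * B)"
    unfolding spectral_profile_def Inf_less_iff by auto
  show ?thesis
  proof (rule good_set_of_function[OF p f(1,3,2) _ _ sym mom])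
    fix a assume a: "a \<in> sym_gens G S"
    have "shift_diff p f a \<le> ennreal (2 * real (card (sym_gens G S))) * energy G p (unif_gens G S) f"
      by (rule shift_diff_le_energy[OF a])
    also have "\<dots> \<le> ennreal (2 * real (card (sym_gens G S))) * ennreal (2 * B)"
      using E by (intro mult_left_mono) auto
    also have "\<dots> = ennreal (4 * real (card (sym_gens G S)) * B)"
      using B by (simp add: ennreal_mult'[symmetric])
    finally show "shift_diff p f a \<le> ennreal (4 * real (card (sym_gens G S)) * B)" .
  qed (use B in simp)
qed

lemma fluct_sum_le_ent:
  assumes mu: "set_pmf \<mu> \<subseteq> carrier G"
  shows "(\<Sum>k<n. fluct \<mu> (conv_power G \<mu> k) / 2) \<le> ent (conv_power G \<mu> n)"
proof (induction n)
  case (Suc n)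
  have "(\<Sum>k<Suc n. fluct \<mu> (conv_power G \<mu> k) / 2) \<le> ent (conv_power G \<mu> n) + fluct \<mu> (conv_power G \<mu> n) / 2"
    using Suc by (simp add: add_mono)
  also have "\<dots> \<le> ent (conv_power G \<mu> (Suc n))"
    using ent_convolution_ge[OF mu set_conv_power[OF mu]] by simp
  finally show ?case .
qed simp

text \<open>
  The one-step increments of entropy absorb the fluctuations met along the two-step recursion for the
  drift; summing over all times, and not only those of the parity of \<open>n\<close>, loses at most a constant
  factor.
\<close>

lemma drift_conv_power_le:
  assumes sym: "symmetric_measure G \<mu>" and M1: "drift \<mu> \<le> ennreal M1"
    and step: "\<And>\<nu>. set_pmf \<nu> \<subseteq> carrier G \<Longrightarrow>
      drift (convolution G (convolution G \<nu> \<mu>) \<mu>) \<le> drift \<nu> + ennreal \<tau> * (fluct \<mu> \<nu> / 2) + ennreal c"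
  shows "drift (conv_power G \<mu> n) \<le> ennreal M1 + ennreal \<tau> * ent (conv_power G \<mu> n) + of_nat n * ennreal c"
proof -
  have mu: "set_pmf \<mu> \<subseteq> carrier G" using sym by (simp add: symmetric_measure_def)
  let ?\<Phi> = "\<lambda>n. (\<Sum>k<n. fluct \<mu> (conv_power G \<mu> k) / 2)"
  have "drift (conv_power G \<mu> n) \<le> ennreal M1 + ennreal \<tau> * ?\<Phi> n + of_nat n * ennreal c"
  proof (induction n rule: induct_nat_012)
    case 0
    then show ?case by (simp add: drift_def)
  next
    case 1
    have "drift (conv_power G \<mu> (Suc 0)) = drift \<mu>"
      using mu unfolding drift_def
      by (simp add: convolution_def bind_return_pmf)
         (intro nn_integral_cong_AE AE_pmfI, auto)
    also have "\<dots> \<le> ennreal M1 + (ennreal \<tau> * ?\<Phi> (Suc 0) + of_nat (Suc 0) * ennreal c)"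
      using M1 by (rule order_trans) simp
    finally show ?case by (simp add: add.assoc)
  next
    case (ge2 n)
    have "drift (conv_power G \<mu> (Suc (Suc n))) \<le>
        drift (conv_power G \<mu> n) + ennreal \<tau> * (fluct \<mu> (conv_power G \<mu> n) / 2) + ennreal c"
      using step[OF set_conv_power[OF mu]] by simp
    also have "\<dots> \<le> (ennreal M1 + ennreal \<tau> * ?\<Phi> n + of_nat n * ennreal c)
        + (ennreal \<tau> * (fluct \<mu> (conv_power G \<mu> n) / 2) + ennreal c)"
      using ge2(1) by (simp add: add.assoc add_right_mono)
    also have "\<dots> = ennreal M1 + ennreal \<tau> * ?\<Phi> (Suc n) + of_nat (Suc n) * ennreal c"
      by (simp add: algebra_simps)
    also have "\<dots> \<le> ennreal M1 + ennreal \<tau> * ?\<Phi> (Suc (Suc n)) + of_nat (Suc (Suc n)) * ennreal c"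
      by (intro add_mono mult_left_mono mult_right_mono of_nat_mono sum_mono2) auto
    finally show ?case .
  qed
  also have "\<dots> \<le> ennreal M1 + ennreal \<tau> * ent (conv_power G \<mu> n) + of_nat n * ennreal c"
    by (intro add_mono mult_left_mono fluct_sum_le_ent mu) auto
  finally show ?thesis .
qed

end

lemma powr_sum_le_moments:
  fixes a b :: nat and p r :: real
  assumes "0 < r" "r \<le> p"
  shows "(real a + real b) powr r \<le> 2 powr p * (real a powr p + real b powr p)"
proof (cases "a + b = 0")
  case False
  define m where "m = max (real a) (real b)"
  have "(real a + real b) powr r \<le> (real a + real b) powr p"
    using False assms by (intro powr_mono) auto
  also have "\<dots> \<le> (2 * m) powr p"
    using assms by (intro powr_mono2) (auto simp: m_def)
  also have "\<dots> = 2 powr p * m powr p" by (simp add: powr_mult)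
  also have "m powr p \<le> real a powr p + real b powr p" by (simp add: m_def max_def)
  finally show ?thesis by simp
qed (use assms in auto)

context marked_group begin

text \<open>
  For \<open>y = 2 ^ j * R\<close> the volume \<open>v = exp y - exp 1\<close> is chosen such that \<open>ln (exp 1 + v)\<close> is exactly
  \<open>y\<close>. The resulting sets have at most \<open>2 * exp y\<close> elements and fail to contain the walk at time \<open>n\<close>
  with probability of order \<open>n * \<l> y / y powr (1 / \<alpha>)\<close>, which is the situation of
  \<open>entropy_finite_sum_le\<close>.
\<close>

lemma entropy_growth:
  fixes \<l> \<omega> :: "real \<Rightarrow> real"
  assumes p: "1 < p" "p \<le> 2" and \<alpha>: "0 < \<alpha>" "\<alpha> < 1"
    and svl: "slowly_varying \<l>" "mono_on {1..} \<l>"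
    and prof: "\<And>v::real. v \<ge> 1 \<Longrightarrow> spectral_profile G p (unif_gens G S) v
             \<le> ennreal (\<l> (ln (exp 1 + v)) / ln (exp 1 + v) powr (1 / \<alpha>))"
    and sym: "symmetric_measure G \<mu>" and mom: "finite_moment G S p \<mu>"
    and svo: "slowly_varying \<omega>" "mono_on {1..} \<omega>"
    and \<eta>: "1 < \<eta>" and dom: "\<And>y. 1 \<le> y \<Longrightarrow> \<l> (y powr (\<alpha> * \<eta>)) powr \<alpha> \<le> \<omega> y"
  shows "\<exists>C\<ge>0. \<forall>n\<ge>1. ent (conv_power G \<mu> n) \<le> ennreal (C * (real n powr \<alpha> * \<omega> (real n)))"
proof -
  have mu: "set_pmf \<mu> \<subseteq> carrier G" using sym by (simp add: symmetric_measure_def)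
  have lpos: "\<l> x > 0" if "1 \<le> x" for x using svl that by (auto simp: slowly_varying_def)
  obtain D K b where D: "0 < D" and K: "0 \<le> K" and b: "1 < b"
    and R2: "\<And>x. 1 \<le> x \<Longrightarrow> 2 \<le> D * x powr \<alpha> * \<omega> x"
    and scale: "\<And>x j. 1 \<le> x \<Longrightarrow> x * (\<l> (2 ^ j * (D * x powr \<alpha> * \<omega> x)) / (2 ^ j * (D * x powr \<alpha> * \<omega> x)) powr (1 / \<alpha>))
        \<le> K * 2 powr (- b * real j)"
    using exists_scale_constants[OF \<alpha> svl svo \<eta> dom] by blast
  have mint: "integrable (measure_pmf \<mu>) (\<lambda>g. real (wl g) powr p)"
    using finite_moment_integral[OF mu mom] by blast
  define M where "M = (\<integral>g. real (wl g) powr p \<partial>measure_pmf \<mu>)"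
  have M: "0 \<le> M" unfolding M_def by simp
  define N where "N = real (card (sym_gens G S))"
  define C where "C = 4 * N * K * M"
  have C: "0 \<le> C" using K M by (simp add: C_def N_def)
  have good: "\<exists>A. finite A \<and> A \<subseteq> carrier G \<and> real (card A) \<le> 2 * exp y \<and>
      (\<forall>n. measure (measure_pmf (conv_power G \<mu> n)) (- A) \<le> real n * (4 * N * (\<l> y / y powr (1 / \<alpha>))) * M)"
    if y: "2 \<le> y" for y
  proof -
    have "exp 1 * exp (y - 1) \<ge> exp 1 * (1 + (y - 1))"
      using exp_ge_add_one_self[of "y - 1"] by (intro mult_left_mono) auto
    then have "exp y \<ge> exp 1 * y" by (simp add: exp_add[symmetric])
    moreover have "exp 1 * y \<ge> exp 1 * 2" using y by (intro mult_left_mono) auto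
    moreover have "exp 1 \<ge> (2::real)" using exp_ge_add_one_self[of 1] by simp
    ultimately have v: "1 \<le> exp y - exp 1" by linarith
    have "spectral_profile G p (unif_gens G S) (exp y - exp 1) \<le> ennreal (\<l> y / y powr (1 / \<alpha>))"
      using prof[OF v] by simp
    moreover have "0 < \<l> y / y powr (1 / \<alpha>)" using y lpos[of y] by simp
    ultimately have "\<exists>A. finite A \<and> A \<subseteq> carrier G \<and> real (card A) \<le> 2 * (exp y - exp 1) \<and>
      (\<forall>n. measure (measure_pmf (conv_power G \<mu> n)) (- A) \<le> real n * (4 * N * (\<l> y / y powr (1 / \<alpha>))) * M)"
      using p by (simp only: N_def M_def) (intro good_set_of_profile sym mint, auto)
    moreover have "2 * (exp y - exp 1) \<le> 2 * exp y" by simp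
    ultimately show ?thesis by (meson order_trans)
  qed
  define C' where "C' = (6 + 2 * C / (1 - 2 powr (1 - b))) * D"
  have C': "0 \<le> C'"
  proof -
    have "2 powr (1 - b) < (1::real)" using b by (simp add: powr_less_one)
    then show ?thesis using C D by (simp add: C'_def)
  qed
  show ?thesis
  proof (intro exI[of _ C'] conjI C' allI impI)
    fix n :: nat assume "1 \<le> n"
    then have n: "1 \<le> real n" by simp
    define R where "R = D * real n powr \<alpha> * \<omega> (real n)"
    have R: "2 \<le> R" using R2[OF n] by (simp add: R_def)
    have yj: "2 \<le> 2 ^ j * R" for j
    proof -
      have "1 * 2 \<le> 2 ^ j * R" using R by (intro mult_mono) auto
      then show ?thesis by simp
    qed
    have "\<forall>j. \<exists>A. finite A \<and> A \<subseteq> carrier G \<and> real (card A) \<le> 2 * exp (2 ^ j * R) \<and>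
      (\<forall>n. measure (measure_pmf (conv_power G \<mu> n)) (- A)
        \<le> real n * (4 * N * (\<l> (2 ^ j * R) / (2 ^ j * R) powr (1 / \<alpha>))) * M)"
      using good[OF yj] by blast
    then obtain A where A: "\<And>j. finite (A j)" "\<And>j. real (card (A j)) \<le> 2 * exp (2 ^ j * R)"
      "\<And>j n. measure (measure_pmf (conv_power G \<mu> n)) (- A j)
        \<le> real n * (4 * N * (\<l> (2 ^ j * R) / (2 ^ j * R) powr (1 / \<alpha>))) * M"
      by metis
    have mass: "measure (measure_pmf (conv_power G \<mu> n)) (- A j) \<le> C * 2 powr (- b * real j)" for j
    proof -
      have "measure (measure_pmf (conv_power G \<mu> n)) (- A j)
          \<le> 4 * N * M * (real n * (\<l> (2 ^ j * R) / (2 ^ j * R) powr (1 / \<alpha>)))"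
        using A(3)[of n j] by (simp add: mult_ac)
      also have "\<dots> \<le> 4 * N * M * (K * 2 powr (- b * real j))"
        using scale[OF n, of j] M by (intro mult_left_mono) (auto simp: R_def N_def)
      finally show ?thesis by (simp add: C_def mult_ac)
    qed
    have "entropy_at G \<mu> n \<le> ennreal (C' / D * R)"
      unfolding entropy_at_def
    proof (rule infsum_le_finite_sums)
      fix F assume F: "finite F" "F \<subseteq> carrier G"
      have "(\<Sum>g\<in>F. - ln (pmf (conv_power G \<mu> n) g) * pmf (conv_power G \<mu> n) g)
          \<le> (6 + 2 * C / (1 - 2 powr (1 - b))) * R"
        using R by (intro entropy_finite_sum_le[OF _ b C A(1,2) mass F(1)]) auto
      then show "(\<Sum>g\<in>F. ennreal (- ln (pmf (conv_power G \<mu> n) g) * pmf (conv_power G \<mu> n) g)) \<le> ennreal (C' / D * R)"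
        using D by (subst sum_ennreal) (auto simp: C'_def pmf_le_1 intro!: ennreal_leI neg_ln_mult_bounds(1)[simplified])
    qed (auto intro: nonneg_summable_on_complete)
    also have "C' / D * R = C' * (real n powr \<alpha> * \<omega> (real n))"
      using D by (simp add: R_def)
    finally show "ent (conv_power G \<mu> n) \<le> ennreal (C' * (real n powr \<alpha> * \<omega> (real n)))"
      by (simp only: entropy_at_eq_ent)
  qed
qed

text \<open>
  The exponent \<open>\<theta> = (p - 1) / 2\<close> is admissible because the moment of order \<open>1 / (1 - \<theta>) = 2 / (3 - p)\<close>
  is finite: \<open>2 / (3 - p) \<le> p\<close> is \<open>(p - 1) * (2 - p) \<ge> 0\<close>. Optimising the weight at time
  \<open>n\<close> gives \<open>n powr (1 - \<theta>)\<close> times the power \<open>\<theta>\<close> of the entropy bound.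
\<close>

lemma drift_growth:
  fixes \<omega> :: "real \<Rightarrow> real"
  assumes p: "1 < p" "p \<le> 2" and \<alpha>: "0 < \<alpha>" "\<alpha> < 1"
    and sym: "symmetric_measure G \<mu>" and mom: "finite_moment G S p \<mu>"
    and svo: "\<And>x. 1 \<le> x \<Longrightarrow> 0 < \<omega> x" "mono_on {1..} \<omega>"
    and H0: "0 \<le> H"
    and H: "\<And>n. 1 \<le> n \<Longrightarrow> ent (conv_power G \<mu> n) \<le> ennreal (H * (real n powr \<alpha> * \<omega> (real n)))"
  shows "\<exists>C\<ge>0. \<forall>n\<ge>1. drift (conv_power G \<mu> n)
     \<le> ennreal (C * (real n powr (((3 - p) + \<alpha> * (p - 1)) / 2) * \<omega> (real n) powr ((p - 1) / 2)))"
proof -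
  have mu: "set_pmf \<mu> \<subseteq> carrier G" using sym by (simp add: symmetric_measure_def)
  define \<theta> where "\<theta> = (p - 1) / 2"
  have th: "0 < \<theta>" "\<theta> \<le> 1 / 2" "\<theta> < 1" using p by (auto simp: \<theta>_def)
  obtain M where M: "0 \<le> M" "(\<integral>\<^sup>+g. ennreal (real (wl g) powr p) \<partial>measure_pmf \<mu>) = ennreal M"
    using finite_moment_integral[OF mu mom] by blast
  have "drift \<mu> \<le> (\<integral>\<^sup>+g. ennreal (real (wl g) powr p) \<partial>measure_pmf \<mu>)"
    unfolding drift_def
  proof (intro nn_integral_mono ennreal_leI)
    fix g
    show "real (wl g) \<le> real (wl g) powr p"
      using p powr_mono[of 1 p "real (wl g)"] by (cases "wl g = 0") auto
  qed
  then have M1: "drift \<mu> \<le> ennreal M" by (simp add: M(2))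
  define W where "W = 2 powr p * (M + M)"
  have W0: "0 \<le> W" using M by (simp add: W_def)
  have W: "(\<integral>\<^sup>+s. \<integral>\<^sup>+t. ennreal ((real (wl s) + real (wl t)) powr (1 / (1 - \<theta>))) \<partial>measure_pmf \<mu> \<partial>measure_pmf \<mu>) \<le> ennreal W"
  proof -
    have r: "0 < 1 / (1 - \<theta>)" "1 / (1 - \<theta>) \<le> p"
    proof -
      have "0 \<le> (p - 1) * (2 - p)" using p by (intro mult_nonneg_nonneg) auto
      then have "2 \<le> p * (3 - p)" by (simp add: algebra_simps)
      then show "1 / (1 - \<theta>) \<le> p" using p by (simp add: \<theta>_def field_simps)
    qed (use th in auto)
    have "(\<integral>\<^sup>+s. \<integral>\<^sup>+t. ennreal ((real (wl s) + real (wl t)) powr (1 / (1 - \<theta>))) \<partial>measure_pmf \<mu> \<partial>measure_pmf \<mu>)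
       \<le> (\<integral>\<^sup>+s. \<integral>\<^sup>+t. ennreal (2 powr p) * (ennreal (real (wl s) powr p) + ennreal (real (wl t) powr p)) \<partial>measure_pmf \<mu> \<partial>measure_pmf \<mu>)"
    proof (intro nn_integral_mono)
      fix s t
      have "ennreal ((real (wl s) + real (wl t)) powr (1 / (1 - \<theta>)))
          \<le> ennreal (2 powr p * (real (wl s) powr p + real (wl t) powr p))"
        by (intro ennreal_leI powr_sum_le_moments r)
      then show "ennreal ((real (wl s) + real (wl t)) powr (1 / (1 - \<theta>)))
          \<le> ennreal (2 powr p) * (ennreal (real (wl s) powr p) + ennreal (real (wl t) powr p))"
        by (simp add: ennreal_mult)
    qed
    also have "\<dots> = ennreal (2 powr p) * (ennreal M + ennreal M)"
      by (simp add: nn_integral_cmult nn_integral_add M(2))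
    also have "\<dots> = ennreal W" using M(1) by (simp only: W_def ennreal_mult'[OF powr_ge_zero] ennreal_plus)
    finally show ?thesis .
  qed
  define C where "C = M / \<omega> 1 powr \<theta> + H + 2 * W"
  have o1: "0 < \<omega> 1" using svo(1)[of 1] by simp
  have C: "0 \<le> C" using M H0 W0 by (simp add: C_def)
  show ?thesis
  proof (intro exI[of _ C] conjI C allI impI)
    fix n :: nat assume "1 \<le> n"
    then have x: "1 \<le> real n" by simp
    define x y where "x = real n" and "y = \<omega> (real n)"
    have x1: "1 \<le> x" and y: "0 < y" "\<omega> 1 \<le> y"
      using x svo by (auto simp: x_def y_def mono_on_def)
    define Q where "Q = x powr (1 - \<theta> + \<alpha> * \<theta>) * y powr \<theta>"
    have Q0: "0 \<le> Q" by (simp add: Q_def)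
    \<comment> \<open>This weight makes the entropy term and the moment term both multiples of \<open>Q\<close>.\<close>
    define \<tau> where "\<tau> = (x powr (1 - \<alpha>) / y) powr (1 - \<theta>)"
    have tau: "0 < \<tau>" using x1 y by (simp add: \<tau>_def)
    let ?c = "2 * \<tau> powr (- \<theta> / (1 - \<theta>)) * W"
    have tauH: "\<tau> * (x powr \<alpha> * y) = Q"
    proof -
      have "\<tau> = x powr ((1 - \<alpha>) * (1 - \<theta>)) / y powr (1 - \<theta>)"
        using x1 y by (simp add: \<tau>_def powr_divide powr_powr)
      then have "\<tau> * (x powr \<alpha> * y) = (x powr ((1 - \<alpha>) * (1 - \<theta>)) * x powr \<alpha>) * (y powr 1 / y powr (1 - \<theta>))"
        using y by simp
      also have "\<dots> = x powr ((1 - \<alpha>) * (1 - \<theta>) + \<alpha>) * y powr (1 - (1 - \<theta>))"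
        by (simp only: powr_add powr_diff)
      also have "\<dots> = Q" by (simp add: Q_def algebra_simps)
      finally show ?thesis .
    qed
    have tauW: "x * \<tau> powr (- \<theta> / (1 - \<theta>)) = Q"
    proof -
      have "\<tau> powr (- \<theta> / (1 - \<theta>)) = (x powr (1 - \<alpha>) / y) powr (- \<theta>)"
        using th by (simp add: \<tau>_def powr_powr)
      also have "\<dots> = x powr (- ((1 - \<alpha>) * \<theta>)) * y powr \<theta>"
        using x1 y by (simp add: powr_divide)
          (simp only: powr_powr powr_minus[of y] divide_inverse inverse_inverse_eq mult_minus_right)
      finally have "x * \<tau> powr (- \<theta> / (1 - \<theta>)) = (x powr 1 * x powr (- ((1 - \<alpha>) * \<theta>))) * y powr \<theta>"
        using x1 by simp
      also have "\<dots> = Q" by (simp only: powr_add[symmetric] Q_def) (simp add: algebra_simps)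
      finally show ?thesis .
    qed
    have QM: "M \<le> M / \<omega> 1 powr \<theta> * Q"
    proof -
      have "1 * \<omega> 1 powr \<theta> \<le> Q" unfolding Q_def
        using x1 y o1 th \<alpha> by (intro mult_mono ge_one_powr_ge_zero powr_mono2) (auto intro: add_nonneg_nonneg)
      then have "M / \<omega> 1 powr \<theta> * \<omega> 1 powr \<theta> \<le> M / \<omega> 1 powr \<theta> * Q"
        using M(1) by (intro mult_left_mono) auto
      then show ?thesis using o1 by simp
    qed
    have "drift (conv_power G \<mu> n) \<le> ennreal M + ennreal \<tau> * ent (conv_power G \<mu> n) + of_nat n * ennreal ?c"
      by (rule drift_conv_power_le[OF sym M1 drift_two_steps_le[OF sym _ tau th(1,2) W0 W]])
    also have "\<dots> \<le> ennreal M + ennreal \<tau> * ennreal (H * (x powr \<alpha> * y)) + of_nat n * ennreal ?c"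
      using H[OF \<open>1 \<le> n\<close>] by (intro add_mono mult_left_mono) (auto simp: x_def y_def)
    also have "\<dots> = ennreal (M + \<tau> * (H * (x powr \<alpha> * y)) + x * ?c)"
    proof -
      have "of_nat n * ennreal ?c = ennreal (x * ?c)"
        by (simp add: x_def ennreal_mult' ennreal_of_nat_eq_real_of_nat)
      moreover have "ennreal \<tau> * ennreal (H * (x powr \<alpha> * y)) = ennreal (\<tau> * (H * (x powr \<alpha> * y)))"
        using tau by (intro ennreal_mult'[symmetric]) auto
      ultimately show ?thesis using M(1) W0 H0 tau x1 y by (simp add: ennreal_plus)
    qed
    also have "\<dots> \<le> ennreal (C * Q)"
    proof (rule ennreal_leI)
      have H_term: "\<tau> * (H * (x powr \<alpha> * y)) = H * Q" unfolding tauH[symmetric] by (simp only: mult_ac)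
      have W_term: "x * ?c = 2 * W * Q" unfolding tauW[symmetric] by (simp only: mult_ac)
      have CQ: "C * Q = M / \<omega> 1 powr \<theta> * Q + H * Q + 2 * W * Q"
        by (simp only: C_def distrib_right)
      show "M + \<tau> * (H * (x powr \<alpha> * y)) + x * ?c \<le> C * Q"
        unfolding H_term W_term CQ using QM by simp
    qed
    also have "Q = real n powr (((3 - p) + \<alpha> * (p - 1)) / 2) * \<omega> (real n) powr ((p - 1) / 2)"
    proof -
      have "1 - \<theta> + \<alpha> * \<theta> = ((3 - p) + \<alpha> * (p - 1)) / 2" by (simp add: \<theta>_def field_simps)
      then show ?thesis by (simp only: Q_def x_def y_def \<theta>_def)
    qed
    finally show "drift (conv_power G \<mu> n) \<le> ennreal (C * (real n powr (((3 - p) + \<alpha> * (p - 1)) / 2) * \<omega> (real n) powr ((p - 1) / 2)))" .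
  qed
qed

end

theorem theorem2p9:
  fixes G :: "('a, 'm) monoid_scheme" and S :: "'a list" and \<mu> :: "'a pmf"
    and p \<alpha> :: real and \<l> \<omega> :: "real \<Rightarrow> real"
  assumes "group G" and "generating_tuple G S"
    and "1 < p" and "p \<le> 2" and "0 < \<alpha>" and "\<alpha> < 1"
    and "slowly_varying \<l>" and "mono_on {1..} \<l>"
    and "\<And>v::real. v \<ge> 1 \<Longrightarrow>
           spectral_profile G p (unif_gens G S) v
             \<le> ennreal (\<l> (ln (exp 1 + v)) / ln (exp 1 + v) powr (1 / \<alpha>))"
    and "symmetric_measure G \<mu>" and "finite_moment G S p \<mu>"
    and "slowly_varying \<omega>" and "mono_on {1..} \<omega>"
    and "\<exists>\<eta>>1. \<exists>\<epsilon>>0. \<forall>y\<ge>1.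
           \<l> (y powr (\<alpha> * \<eta>)) powr \<alpha> * ln (exp 1 + y powr (\<alpha> * \<eta>)) powr (\<alpha> * (1 + \<epsilon>)) \<le> \<omega> y"
  shows "(\<exists>C::real. \<forall>n\<ge>1. entropy_at G \<mu> n \<le> ennreal (C * real n powr \<alpha> * \<omega> (real n)))
       \<and> (\<exists>C::real. \<forall>n\<ge>1. drift_at G S \<mu> n
            \<le> ennreal (C * real n powr (((3 - p) + \<alpha> * (p - 1)) / 2) * \<omega> (real n) powr ((p - 1) / 2)))"
proof -
  interpret marked_group G S
    using assms(1,2) by (simp add: marked_group_def marked_group_axioms_def)
  have mu: "set_pmf \<mu> \<subseteq> carrier G" using assms(10) by (simp add: symmetric_measure_def)
  obtain \<eta> \<epsilon> where \<eta>: "1 < \<eta>" "0 < \<epsilon>"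
    and dom': "\<And>y. 1 \<le> y \<Longrightarrow> \<l> (y powr (\<alpha> * \<eta>)) powr \<alpha> * ln (exp 1 + y powr (\<alpha> * \<eta>)) powr (\<alpha> * (1 + \<epsilon>)) \<le> \<omega> y"
    using assms(14) by blast
  have dom: "\<l> (y powr (\<alpha> * \<eta>)) powr \<alpha> \<le> \<omega> y" if y: "1 \<le> y" for y
  proof -
    have "ln (exp 1) \<le> ln (exp 1 + y powr (\<alpha> * \<eta>))" by (intro ln_mono) (auto intro: add_pos_nonneg)
    then have "1 \<le> ln (exp 1 + y powr (\<alpha> * \<eta>)) powr (\<alpha> * (1 + \<epsilon>))"
      using assms(5) \<eta> by (intro ge_one_powr_ge_zero) auto
    then have "\<l> (y powr (\<alpha> * \<eta>)) powr \<alpha> * 1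
        \<le> \<l> (y powr (\<alpha> * \<eta>)) powr \<alpha> * ln (exp 1 + y powr (\<alpha> * \<eta>)) powr (\<alpha> * (1 + \<epsilon>))"
      by (intro mult_left_mono) auto
    then show ?thesis using dom'[OF y] by simp
  qed
  obtain H where H: "0 \<le> H"
    "\<And>n. 1 \<le> n \<Longrightarrow> ent (conv_power G \<mu> n) \<le> ennreal (H * (real n powr \<alpha> * \<omega> (real n)))"
    using entropy_growth[OF assms(3-13) \<eta>(1) dom] by blast
  have opos: "\<And>x. 1 \<le> x \<Longrightarrow> 0 < \<omega> x" using assms(12) by (auto simp: slowly_varying_def)
  obtain C where C: "\<And>n. 1 \<le> n \<Longrightarrow> drift (conv_power G \<mu> n)
     \<le> ennreal (C * (real n powr (((3 - p) + \<alpha> * (p - 1)) / 2) * \<omega> (real n) powr ((p - 1) / 2)))"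
    using drift_growth[OF assms(3-6,10,11) opos assms(13) H] by blast
  show ?thesis
    unfolding entropy_at_eq_ent drift_at_eq_drift[OF mu] using H(2) C
    by (auto simp: mult.assoc)
qed

end
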